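(* For every $n\ge 1$ there is a bounded domain $D\subset\subset\mathbb{C}^n$ such that every holomorphic map $f:D\to D$ fixing two distinct points of $D$ is the identity, and such that $D$ has no non-trivial holomorphic retraction; that is, every holomorphic map $f:D\to D$ with $f\circ f=f$ is either a constant map or the identity.
   Context: A domain is a connected nonempty open set. A holomorphic retraction of $D$ is a holomorphic map $f:D\to D$ with $f\circ f=f$. It is called trivial if it is either a constant map or the identity. *)

theory Defs
  imports "HOL-Analysis.Analysis"
begin

definition cn_domain :: "(complex ^ 'n) set \<Rightarrow> bool"
  where "cn_domain D \<longleftrightarrow> open D \<and> connected D \<and> D \<noteq> {}"

(* Holomorphy in several variables: the real Frechet derivative exists at every point and is
   complex linear, i.e. given by a complex Jacobian matrix. *)
definition holomorphic_map_on ::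
    "(complex ^ 'n \<Rightarrow> complex ^ 'm) \<Rightarrow> (complex ^ 'n) set \<Rightarrow> bool"
  where "holomorphic_map_on f D \<longleftrightarrow>
    (\<forall>z\<in>D. \<exists>A :: complex ^ 'n ^ 'm. (f has_derivative (\<lambda>v. A *v v)) (at z within D))"

(* Self-maps of D are total functions; only their values on D matter. *)
definition holomorphic_self_map :: "(complex ^ 'n \<Rightarrow> complex ^ 'n) \<Rightarrow> (complex ^ 'n) set \<Rightarrow> bool"
  where "holomorphic_self_map f D \<longleftrightarrow> holomorphic_map_on f D \<and> f ` D \<subseteq> D"

definition holomorphic_retraction :: "(complex ^ 'n \<Rightarrow> complex ^ 'n) \<Rightarrow> (complex ^ 'n) set \<Rightarrow> bool"
  where "holomorphic_retraction f D \<longleftrightarrow>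
    holomorphic_self_map f D \<and> (\<forall>z\<in>D. f (f z) = f z)"

definition trivial_on :: "(complex ^ 'n \<Rightarrow> complex ^ 'n) \<Rightarrow> (complex ^ 'n) set \<Rightarrow> bool"
  where "trivial_on f D \<longleftrightarrow> f constant_on D \<or> (\<forall>z\<in>D. f z = z)"

end

theory Submission
  imports Defs "HOL-Complex_Analysis.Riemann_Mapping"
begin

text \<open>For \<open>n = 1\<close> take the unit disc and apply the Schwarz lemma. For \<open>n \<ge> 2\<close> remove from the unit
  ball a sequence of concentric spheres \<open>S\<^sub>k\<close> accumulating at the boundary, leaving in each a
  small cap around a coordinate axis, so that the domain \<open>D\<close> stays connected. By Hartogs, a
  self-map of \<open>D\<close> extends to a self-map \<open>F\<close> of the ball. If \<open>F\<close> fixes two points, it fixes their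
  complex line pointwise by the Schwarz lemma. This line crosses every \<open>S\<^sub>k\<close> with large \<open>k\<close>
  outside the cap; since \<open>F\<close> maps \<open>D\<close> to itself, near such a crossing it preserves both sides
  of \<open>S\<^sub>k\<close>, hence \<open>S\<^sub>k\<close>, and by Schwarz reflection along complex lines it maps all of \<open>S\<^sub>k\<close> into
  \<open>S\<^sub>k\<close>. Three such spheres and the maximum principle for \<open>F (t v) / t\<close> make \<open>F\<close> a linear
  isometry, and mapping each cap into itself, \<open>F\<close> fixes every coordinate axis. A non-constant
  retraction fixes the two or more points of its image.\<close>

section \<open>Hermitian geometry of complex lines\<close>

text \<open>The cap condition \<open>(rad k)^2 < Re (z $ g k)\<close> is shaped by two needs. The
  real part breaks rotational symmetry: caps given by \<open>cmod (z $ g k)\<close> would be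
  preserved by every diagonal unitary map, and such a map can fix a whole axis without being the
  identity. The height \<open>(rad k)^2\<close> stays below \<open>rad k\<close>, so no cap is
  empty, but tends to 1, so a line whose distance from the origin is less than 1 finally leaves the
  caps. That distance can be arbitrarily close to 1, which is why infinitely many spheres are
  removed. Every argument in several variables is reduced to complex lines. They cut balls and
  shells in discs and annuli, where the one-variable identity theorem, the maximum principle and the
  Schwarz lemma apply. Slices of \<open>D\<close> itself may be disconnected, so statements spread
  over \<open>D\<close> along chains of shells and small balls.\<close>

definition herm :: "complex ^ 'n \<Rightarrow> complex ^ 'n \<Rightarrow> complex"
  where "herm x y = (\<Sum>i\<in>UNIV. x $ i * cnj (y $ i))"

lemma norm_vec_sq: "(norm (x :: complex ^ 'n))\<^sup>2 = (\<Sum>i\<in>UNIV. (cmod (x $ i))\<^sup>2)"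
  by (simp add: norm_vec_def L2_set_def sum_nonneg)

lemma norm_axis: "norm (axis i x :: complex ^ 'n) = cmod x"
proof -
  have "(norm (axis i x :: complex ^ 'n))\<^sup>2 = (\<Sum>j\<in>UNIV. if j = i then (cmod x)\<^sup>2 else 0)"
    unfolding norm_vec_sq by (rule sum.cong) (auto simp: axis_def)
  then show ?thesis
    using power2_eq_iff_nonneg[of "norm (axis i x :: complex ^ 'n)" "cmod x"] by simp
qed

lemma herm_self: "herm x x = of_real ((norm x)\<^sup>2)"
  by (simp add: herm_def norm_vec_sq flip: complex_norm_square)

lemma Re_herm: "Re (herm x y) = x \<bullet> y"
  by (simp add: herm_def inner_vec_def inner_complex_def)

lemma herm_add_left: "herm (x + y) z = herm x z + herm y z"
  by (simp add: herm_def sum.distrib algebra_simps)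

lemma herm_diff_left: "herm (x - y) z = herm x z - herm y z"
  by (simp add: herm_def sum_subtractf algebra_simps)

lemma herm_scale_left: "herm (c *s x) z = c * herm x z"
  by (simp add: herm_def sum_distrib_left algebra_simps)

lemma cnj_herm: "cnj (herm x y) = herm y x"
  by (simp add: herm_def mult.commute)

lemma norm_herm_le: "cmod (herm x y) \<le> norm x * norm y"
proof -
  have "cmod (herm x y) \<le> (\<Sum>i\<in>UNIV. \<bar>cmod (x $ i)\<bar> * \<bar>cmod (y $ i)\<bar>)"
    unfolding herm_def by (rule order_trans[OF norm_sum]) (simp add: norm_mult)
  also have "\<dots> \<le> norm x * norm y"
    unfolding norm_vec_def by (rule L2_set_mult_ineq)
  finally show ?thesis .
qed

lemma norm_vscale: "norm (c *s (x :: complex ^ 'n)) = cmod c * norm x"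
proof -
  have "(norm (c *s x))\<^sup>2 = (cmod c * norm x)\<^sup>2"
    by (simp add: norm_vec_sq power_mult_distrib norm_mult sum_distrib_left)
  then show ?thesis
    using power2_eq_iff_nonneg[of "norm (c *s x)" "cmod c * norm x"] by simp
qed

lemma norm_sq_add:
  "(norm (x + y :: complex ^ 'n))\<^sup>2 = (norm x)\<^sup>2 + 2 * Re (herm x y) + (norm y)\<^sup>2"
  by (simp add: Re_herm power2_norm_eq_inner inner_add inner_commute)

lemma norm_sq_diff:
  "(norm (x - y :: complex ^ 'n))\<^sup>2 = (norm x)\<^sup>2 - 2 * Re (herm x y) + (norm y)\<^sup>2"
  by (simp add: Re_herm power2_norm_eq_inner inner_diff inner_commute)

text \<open>Pythagoras. With \<open>c\<close> orthogonal to \<open>u\<close>, the norm on the line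
  depends on \<open>cmod t\<close> alone, so balls, spheres and shells are cut in discs, circles and
  annuli around \<open>t = 0\<close>.\<close>

lemma norm_sq_orthogonal_line:
  assumes "herm c u = 0" "norm u = 1"
  shows "(norm (c + t *s u))\<^sup>2 = (norm c)\<^sup>2 + (cmod t)\<^sup>2"
proof -
  have "herm c (t *s u) = cnj (herm (t *s u) c)"
    by (simp add: cnj_herm)
  also have "\<dots> = cnj t * herm c u"
    by (simp add: herm_scale_left cnj_herm)
  finally show ?thesis
    using assms by (simp add: norm_sq_add norm_vscale power_mult_distrib)
qed

text \<open>\<open>c\<close> is the foot of the perpendicular from the origin to the complex line
  through \<open>a\<close> and \<open>b\<close>.\<close>

lemma line_normal_form:
  fixes a b :: "complex ^ 'n"
  assumes "a \<noteq> b"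
  obtains c u s t where "norm u = 1" "herm c u = 0" "a = c + s *s u" "b = c + t *s u" "s \<noteq> t"
proof -
  define N where "N = norm (b - a)"
  have N: "N > 0" using assms by (simp add: N_def)
  define u where "u = (of_real (1 / N) :: complex) *s (b - a)"
  define s where "s = herm a u"
  define c where "c = a - s *s u"
  have u: "norm u = 1"
    using N by (simp add: u_def norm_vscale norm_divide del: vector_ssub_ldistrib flip: N_def)
  have "herm c u = 0"
    using u by (simp add: c_def herm_diff_left herm_scale_left herm_self s_def)
  moreover have "a = c + s *s u" by (simp add: c_def)
  moreover have "b = c + (s + of_real N) *s u"
  proof -
    have "complex_of_real N *s u = b - a"
      using N by (simp add: u_def vector_smult_assoc flip: of_real_mult)
    then show ?thesis
      by (simp add: c_def vector_sadd_rdistrib)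
  qed
  ultimately show ?thesis
    using u N by (intro that[of u c s "s + of_real N"]) auto
qed

lemma bounded_linear_vscale: "bounded_linear (\<lambda>t. t *s (v :: complex ^ 'n))"
  by (rule bounded_linear_intro[where K = "norm v"])
     (simp_all add: vector_sadd_rdistrib norm_vscale vec_eq_iff)

lemma continuous_on_line: "continuous_on S (\<lambda>t. p + t *s (v :: complex ^ 'n))"
  by (intro continuous_intros bounded_linear.continuous_on[OF bounded_linear_vscale])

lemma open_line_slice: "open S \<Longrightarrow> open {t. p + t *s (v :: complex ^ 'n) \<in> S}"
  using open_vimage[OF _ continuous_on_line[of UNIV p v], of S] by (simp add: vimage_def)

section \<open>Holomorphy along complex lines and Hartogs extension\<close>

text \<open>Holomorphy along complex lines is all the regularity the Hartogs extension needs to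
  carry; together with boundedness it implies continuity (Schwarz lemma).\<close>

definition lhol :: "(complex ^ 'n \<Rightarrow> complex) \<Rightarrow> (complex ^ 'n) set \<Rightarrow> bool"
  where "lhol f S \<longleftrightarrow> (\<forall>p v. (\<lambda>t. f (p + t *s v)) holomorphic_on {t. p + t *s v \<in> S})"

lemma lholD: "lhol f S \<Longrightarrow> (\<And>t. t \<in> T \<Longrightarrow> p + t *s v \<in> S) \<Longrightarrow> (\<lambda>t. f (p + t *s v)) holomorphic_on T"
  unfolding lhol_def by (blast intro: holomorphic_on_subset)

lemma lhol_subset: "lhol f S \<Longrightarrow> T \<subseteq> S \<Longrightarrow> lhol f T"
  unfolding lhol_def by (blast intro: holomorphic_on_subset)

lemma lhol_cong: "lhol f S \<Longrightarrow> (\<And>z. z \<in> S \<Longrightarrow> f z = g z) \<Longrightarrow> lhol g S"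
  unfolding lhol_def
  by (metis (mono_tags, lifting) holomorphic_cong mem_Collect_eq)

lemma lhol_locally:
  assumes "\<And>z. z \<in> S \<Longrightarrow> \<exists>T. open T \<and> z \<in> T \<and> lhol f T"
  shows "lhol f S"
  unfolding lhol_def
proof (intro allI)
  fix p v
  show "(\<lambda>t. f (p + t *s v)) holomorphic_on {t. p + t *s v \<in> S}"
    unfolding holomorphic_on_def
  proof
    fix t assume "t \<in> {t. p + t *s v \<in> S}"
    with assms obtain T where T: "open T" "p + t *s v \<in> T" "lhol f T" by blast
    have "(\<lambda>t. f (p + t *s v)) field_differentiable at t"
      using T lholD[OF T(3), of "{t. p + t *s v \<in> T}" p v] open_line_slice[OF T(1), of p v]
      by (auto simp: holomorphic_on_open field_differentiable_def)
    then show "(\<lambda>t. f (p + t *s v)) field_differentiable at t within {t. p + t *s v \<in> S}"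
      by (rule field_differentiable_at_within)
  qed
qed

lemma has_field_derivative_line:
  fixes A :: "complex ^ 'n ^ 'm"
  assumes A: "(f has_derivative (\<lambda>v. A *v v)) (at (p + t *s v))"
  shows "((\<lambda>t. f (p + t *s v) $ i) has_field_derivative (A *v v) $ i) (at t)"
proof -
  have "((\<lambda>t. p + t *s v) has_derivative (\<lambda>t. t *s v)) (at t)"
    using has_derivative_add[OF has_derivative_const bounded_linear_imp_has_derivative[OF bounded_linear_vscale]]
    by simp
  from diff_chain_at[OF this A]
  have "((\<lambda>t. f (p + t *s v)) has_derivative (\<lambda>t. A *v (t *s v))) (at t)"
    by (simp add: o_def)
  then have "((\<lambda>t. f (p + t *s v) $ i) has_derivative (\<lambda>t. (A *v (t *s v)) $ i)) (at t)"
    by (rule bounded_linear.has_derivative[OF bounded_linear_vec_nth])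
  moreover have "(\<lambda>t. (A *v (t *s v)) $ i) = (*) ((A *v v) $ i)"
    by (simp add: fun_eq_iff matrix_vector_mult_def sum_distrib_left mult_ac)
  ultimately show ?thesis
    by (simp add: has_field_derivative_def)
qed

lemma holomorphic_map_onD:
  fixes f :: "complex ^ 'n \<Rightarrow> complex ^ 'm"
  assumes "holomorphic_map_on f D" "open D" "z \<in> D"
  obtains A where "(f has_derivative (\<lambda>v. A *v v)) (at z)"
  using assms(1,3) at_within_open[OF assms(3,2)] that unfolding holomorphic_map_on_def by metis

lemma holomorphic_map_lhol:
  assumes "holomorphic_map_on f D" "open D"
  shows "lhol (\<lambda>z. f z $ i) D"
  unfolding lhol_def
proof (intro allI)
  fix p v
  have o: "open {t. p + t *s v \<in> D}" by (rule open_line_slice[OF assms(2)])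
  show "(\<lambda>t. f (p + t *s v) $ i) holomorphic_on {t. p + t *s v \<in> D}"
    unfolding holomorphic_on_open[OF o]
  proof
    fix t assume "t \<in> {t. p + t *s v \<in> D}"
    then obtain A where A: "(f has_derivative (\<lambda>v. A *v v)) (at (p + t *s v))"
      using holomorphic_map_onD[OF assms] by blast
    from has_field_derivative_line[OF this]
    show "\<exists>f'. ((\<lambda>t. f (p + t *s v) $ i) has_field_derivative f') (at t)" by blast
  qed
qed

lemma holomorphic_map_continuous:
  assumes "holomorphic_map_on f D" shows "continuous_on D f"
  using assms unfolding holomorphic_map_on_def continuous_on_eq_continuous_within
  by (blast intro: has_derivative_continuous)

text \<open>The one-variable identity theorem on the complex line from \<open>w\<close> to
  \<open>z\<close>. This is why connectedness is asked of the slices of \<open>S\<close> and not of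
  \<open>S\<close>.\<close>

lemma lhol_identity:
  assumes f: "lhol f S" and g: "lhol g S" and S: "open S"
    and conn: "\<And>p v. connected {t. p + t *s v \<in> S}"
    and W: "open W" "w \<in> W" "W \<subseteq> S" and eq: "\<And>z. z \<in> W \<Longrightarrow> f z = g z" and z: "z \<in> S"
  shows "f z = g z"
proof -
  obtain v where v: "z = w + 1 *s v"
    by (rule that[of "z - w"]) simp
  let ?T = "{t. w + t *s v \<in> S}" and ?U = "{t. w + t *s v \<in> W}"
  have "f (w + 1 *s v) = g (w + 1 *s v)"
  proof (rule analytic_continuation_open[of ?U ?T "\<lambda>t. f (w + t *s v)" "\<lambda>t. g (w + t *s v)"])
    show "open ?U" using W(1) by (rule open_line_slice)
    show "open ?T" using S by (rule open_line_slice)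
    have "0 \<in> ?U" using W by simp
    then show "?U \<noteq> {}" by blast
    show "connected ?T" by (rule conn)
    show "?U \<subseteq> ?T" using W by blast
    show "(\<lambda>t. f (w + t *s v)) holomorphic_on ?T" "(\<lambda>t. g (w + t *s v)) holomorphic_on ?T"
      by (rule lholD[OF f], simp, rule lholD[OF g], simp)
    show "f (w + t *s v) = g (w + t *s v)" if "t \<in> ?U" for t using eq that by simp
    show "1 \<in> ?T" using z v by simp
  qed
  then show ?thesis by (simp add: v)
qed

lemma connected_slice_convex: "convex S \<Longrightarrow> connected {t. p + t *s (v :: complex ^ 'n) \<in> S}"
proof (rule convex_connected)
  assume S: "convex S"
  show "convex {t. p + t *s v \<in> S}"
    unfolding convex_alt
  proof (clarify)
    fix x y :: complex and u :: real assume *: "p + x *s v \<in> S" "p + y *s v \<in> S" "0 \<le> u" "u \<le> 1"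
    have "p + ((1 - u) *\<^sub>R x + u *\<^sub>R y) *s v = (1 - u) *\<^sub>R (p + x *s v) + u *\<^sub>R (p + y *s v)"
      by (simp add: vec_eq_iff algebra_simps)
    then show "p + ((1 - u) *\<^sub>R x + u *\<^sub>R y) *s v \<in> S"
      using S * unfolding convex_alt by metis
  qed
qed

lemma less_sq: "0 \<le> x \<Longrightarrow> 0 \<le> y \<Longrightarrow> x\<^sup>2 < y\<^sup>2 \<longleftrightarrow> x < (y :: real)"
  by (simp flip: not_le)

lemma connected_slice_shell:
  "connected {t. p + t *s (v :: complex ^ 'n) \<in> {z. a < norm z \<and> norm z < b}}"
proof (cases "v = 0")
  case True
  then show ?thesis by (cases "a < norm p \<and> norm p < b") auto
next
  case False
  then have "p \<noteq> p + v" by simp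
  then obtain c u s t where u: "norm u = 1" "herm c u = 0" "p = c + s *s u" "p + v = c + t *s u" "s \<noteq> t"
    by (rule line_normal_form)
  define d where "d = t - s"
  have d: "d \<noteq> 0" using u by (simp add: d_def)
  have d2: "(cmod d)\<^sup>2 > 0" using d by simp
  have v: "v = d *s u"
  proof -
    have "v = (p + v) - p" by simp
    also have "\<dots> = (c + t *s u) - (c + s *s u)" by (subst u(4), subst u(3), rule refl)
    also have "\<dots> = d *s u" unfolding d_def by (simp add: vec_eq_iff algebra_simps)
    finally show ?thesis .
  qed
  have n: "(norm (p + x *s v))\<^sup>2 = (norm c)\<^sup>2 + (cmod d)\<^sup>2 * (cmod (x - (- s / d)))\<^sup>2" for x
  proof -
    have "p + x *s v = c + (d * (x - (- s / d))) *s u"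
      using d unfolding u(3) v by (simp add: vec_eq_iff field_simps)
    then show ?thesis
      using norm_sq_orthogonal_line[OF u(2,1)] by (simp add: norm_mult power_mult_distrib)
  qed
  \<comment> \<open>\<open>sqrt\<close> is odd: a negative radicand yields a negative radius, so the
    bound \<open>lo\<close> then always holds and the bound \<open>hi\<close> never does, as it
    should when the foot \<open>c\<close> lies beyond the respective sphere. The value -1 does the
    same for negative \<open>a\<close> or \<open>b\<close>.\<close>
  define lo where "lo = (if a < 0 then -1 else sqrt ((a\<^sup>2 - (norm c)\<^sup>2) / (cmod d)\<^sup>2))"
  define hi where "hi = (if b < 0 then -1 else sqrt ((b\<^sup>2 - (norm c)\<^sup>2) / (cmod d)\<^sup>2))"
  have L: "a < norm (p + x *s v) \<longleftrightarrow> lo < cmod (x - (- s / d))" for x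
  proof (cases "a < 0")
    case True
    then have "lo = -1" by (simp add: lo_def)
    then have "a < norm (p + x *s v)" "lo < cmod (x - (- s / d))"
      using True norm_ge_zero[of "p + x *s v"] norm_ge_zero[of "x - (- s / d)"] \<open>lo = -1\<close>
      by linarith+
    then show ?thesis by simp
  next
    case False
    then have "a < norm (p + x *s v) \<longleftrightarrow> a\<^sup>2 < (norm (p + x *s v))\<^sup>2"
      by (simp add: less_sq)
    also have "\<dots> \<longleftrightarrow> (a\<^sup>2 - (norm c)\<^sup>2) / (cmod d)\<^sup>2 < (cmod (x - (- s / d)))\<^sup>2"
      unfolding n using pos_divide_less_eq[OF d2] by (simp add: mult.commute diff_less_eq add.commute)
    also have "\<dots> \<longleftrightarrow> lo < cmod (x - (- s / d))"
      using False real_sqrt_less_iff[of "(a\<^sup>2 - (norm c)\<^sup>2) / (cmod d)\<^sup>2" "(cmod (x - (- s / d)))\<^sup>2"]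
      by (simp add: lo_def)
    finally show ?thesis .
  qed
  have H: "norm (p + x *s v) < b \<longleftrightarrow> cmod (x - (- s / d)) < hi" for x
  proof (cases "b < 0")
    case True
    then have "hi = -1" by (simp add: hi_def)
    then have "\<not> norm (p + x *s v) < b" "\<not> cmod (x - (- s / d)) < hi"
      using True norm_ge_zero[of "p + x *s v"] norm_ge_zero[of "x - (- s / d)"] \<open>hi = -1\<close>
      by linarith+
    then show ?thesis by simp
  next
    case False
    then have "norm (p + x *s v) < b \<longleftrightarrow> (norm (p + x *s v))\<^sup>2 < b\<^sup>2"
      by (simp add: less_sq)
    also have "\<dots> \<longleftrightarrow> (cmod (x - (- s / d)))\<^sup>2 < (b\<^sup>2 - (norm c)\<^sup>2) / (cmod d)\<^sup>2"
      unfolding n using pos_less_divide_eq[OF d2] by (simp add: mult.commute less_diff_eq add.commute)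
    also have "\<dots> \<longleftrightarrow> cmod (x - (- s / d)) < hi"
      using False real_sqrt_less_iff[of "(cmod (x - (- s / d)))\<^sup>2" "(b\<^sup>2 - (norm c)\<^sup>2) / (cmod d)\<^sup>2"]
      by (simp add: hi_def)
    finally show ?thesis .
  qed
  have "{t. p + t *s v \<in> {z. a < norm z \<and> norm z < b}} = {x. lo < cmod (x - (- s / d)) \<and> cmod (x - (- s / d)) < hi}"
    by (simp only: L H mem_Collect_eq)
  moreover have "connected \<dots>"
    by (rule connected_annulus) simp
  ultimately show ?thesis by simp
qed

section \<open>Contour integrals depending on a parameter\<close>

lemma continuous_on_contour_integral_param:
  assumes cont: "continuous_on (S \<times> path_image g) (\<lambda>(x, z). h x z)"
    and g: "path g" "continuous_on {0..1} (\<lambda>t. vector_derivative g (at t))"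
  shows "continuous_on S (\<lambda>x. contour_integral g (h x))"
proof -
  have 1: "continuous_on (S \<times> {0..1::real}) (\<lambda>y. g (snd y))"
    using g(1) unfolding path_def
    by (rule continuous_on_compose2) (auto intro: continuous_on_snd continuous_on_id)
  have 2: "continuous_on (S \<times> {0..1::real}) (\<lambda>y. vector_derivative g (at (snd y)))"
    using g(2) by (rule continuous_on_compose2) (auto intro: continuous_on_snd continuous_on_id)
  have "continuous_on (S \<times> {0..1::real}) (\<lambda>y. (\<lambda>(x, z). h x z) (fst y, g (snd y)))"
    using cont
    by (rule continuous_on_compose2)
       (auto intro!: continuous_on_Pair 1 continuous_on_fst continuous_on_id simp: path_image_def)
  from continuous_on_mult[OF this 2]
  have "continuous_on (S \<times> cbox 0 1) (\<lambda>(x, t). h x (g t) * vector_derivative g (at t))"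
    by (simp only: case_prod_unfold fst_conv snd_conv cbox_interval)
  from integral_continuous_on_param[OF this] show ?thesis
    by (simp add: contour_integral_integral)
qed

text \<open>Morera's theorem: the integral over a triangle is exchanged with the one over the
  circle, and the inner triangle integral vanishes by Cauchy's theorem.\<close>

lemma holomorphic_on_circlepath_integral_param:
  assumes U: "open U" and R: "R > 0"
    and cont: "continuous_on (U \<times> sphere 0 R) (\<lambda>(x, z). h x z)"
    and hol: "\<And>z. z \<in> sphere 0 R \<Longrightarrow> (\<lambda>x. h x z) holomorphic_on U"
  shows "(\<lambda>x. contour_integral (circlepath 0 R) (h x)) holomorphic_on U"
proof -
  let ?C = "circlepath 0 R"
  have vC: "continuous_on {0..1} (\<lambda>t. vector_derivative ?C (at t))"
    by (auto simp: vector_derivative_circlepath intro!: continuous_intros)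
  have vL: "continuous_on {0..1} (\<lambda>t. vector_derivative (linepath a b) (at t))" for a b :: complex
    by simp
  have pC: "path_image ?C = sphere 0 R" using R by simp
  have contF: "continuous_on U (\<lambda>x. contour_integral ?C (h x))"
    using continuous_on_contour_integral_param[of U ?C h, unfolded pC, OF cont _ vC] by simp
  have "(\<lambda>x. contour_integral ?C (h x)) analytic_on U"
  proof (rule Morera_triangle[OF contF U], intro impI)
    fix a b c assume sub: "convex hull {a, b, c} \<subseteq> U"
    have seg: "closed_segment a b \<subseteq> U" "closed_segment b c \<subseteq> U" "closed_segment c a \<subseteq> U"
      by (rule order_trans[OF _ sub], rule segments_subset_convex_hull)+
    have swap: "contour_integral (linepath x y) (\<lambda>w. contour_integral ?C (h w)) =
        contour_integral ?C (\<lambda>z. contour_integral (linepath x y) (\<lambda>w. h w z))"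
      and int: "(\<lambda>z. contour_integral (linepath x y) (\<lambda>w. h w z)) contour_integrable_on ?C"
      if xy: "closed_segment x y \<subseteq> U" for x y
    proof -
      show "contour_integral (linepath x y) (\<lambda>w. contour_integral ?C (h w)) =
        contour_integral ?C (\<lambda>z. contour_integral (linepath x y) (\<lambda>w. h w z))"
      proof (rule contour_integral_swap)
        show "continuous_on (path_image (linepath x y) \<times> path_image ?C) (\<lambda>(w, z). h w z)"
          unfolding pC path_image_linepath by (rule continuous_on_subset[OF cont]) (use xy in auto)
      qed (auto simp: vC)
      have "continuous_on (sphere 0 R \<times> closed_segment x y) (\<lambda>y. (\<lambda>(x, z). h x z) (snd y, fst y))"
        using xy by (intro continuous_on_compose2[OF cont] continuous_intros) auto
      then have "continuous_on (sphere 0 R \<times> path_image (linepath x y)) (\<lambda>(z, w). h w z)"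
        by (simp add: case_prod_unfold)
      from continuous_on_contour_integral_param[OF this _ vL]
      show "(\<lambda>z. contour_integral (linepath x y) (\<lambda>w. h w z)) contour_integrable_on ?C"
        by (intro contour_integrable_continuous_circlepath) (auto simp only: pC path_linepath)
    qed
    have "contour_integral ?C (\<lambda>z. contour_integral (linepath a b) (\<lambda>w. h w z)) +
        contour_integral ?C (\<lambda>z. contour_integral (linepath b c) (\<lambda>w. h w z)) +
        contour_integral ?C (\<lambda>z. contour_integral (linepath c a) (\<lambda>w. h w z)) =
      contour_integral ?C (\<lambda>z. contour_integral (linepath a b) (\<lambda>w. h w z) +
        contour_integral (linepath b c) (\<lambda>w. h w z) + contour_integral (linepath c a) (\<lambda>w. h w z))"
      using int seg by (simp add: contour_integral_add contour_integrable_add)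
    also have "\<dots> = contour_integral ?C (\<lambda>z. 0)"
    proof (rule contour_integral_eq)
      fix z assume "z \<in> path_image ?C"
      then have "z \<in> sphere 0 R" by (simp only: pC)
      then have hz: "(\<lambda>w. h w z) holomorphic_on convex hull {a, b, c}"
        using hol sub holomorphic_on_subset by blast
      have hull0: "((\<lambda>w. h w z) has_contour_integral 0) (linepath a b +++ linepath b c +++ linepath c a)"
        by (rule Cauchy_theorem_triangle[OF hz])
      have "(\<lambda>w. h w z) contour_integrable_on linepath x y"
        if "closed_segment x y \<subseteq> convex hull {a, b, c}" for x y
        using that hz by (intro contour_integrable_continuous_linepath)
          (blast intro: holomorphic_on_imp_continuous_on continuous_on_subset)
      from this[of a b] this[of b c] this[of c a]
      have "((\<lambda>w. h w z) has_contour_integral contour_integral (linepath a b) (\<lambda>w. h w z) +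
          (contour_integral (linepath b c) (\<lambda>w. h w z) + contour_integral (linepath c a) (\<lambda>w. h w z)))
          (linepath a b +++ linepath b c +++ linepath c a)"
        by (intro has_contour_integral_join has_contour_integral_integral valid_path_join)
           (auto simp: segments_subset_convex_hull)
      with hull0 show "contour_integral (linepath a b) (\<lambda>w. h w z) +
        contour_integral (linepath b c) (\<lambda>w. h w z) + contour_integral (linepath c a) (\<lambda>w. h w z) = 0"
        by (simp add: has_contour_integral_unique add.assoc)
    qed
    also have "\<dots> = 0" by simp
    finally show "contour_integral (linepath a b) (\<lambda>x. contour_integral ?C (h x)) +
       contour_integral (linepath b c) (\<lambda>x. contour_integral ?C (h x)) +
       contour_integral (linepath c a) (\<lambda>x. contour_integral ?C (h x)) = 0"
      using swap seg by simp
  qed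
  then show ?thesis by (rule analytic_imp_holomorphic)
qed

text \<open>The extension is the Cauchy integral in one coordinate direction over any circle (radius
  \<open>R\<close> admissible for \<open>z\<close>) that lies in the shell and encloses \<open>z\<close>; it agrees with \<open>f\<close> where the
  whole disc lies in the shell.\<close>

lemma hartogs_shell:
  fixes f :: "complex ^ 'n \<Rightarrow> complex" and a b :: real
  defines "Sh \<equiv> {z. a < norm z \<and> norm z < b}"
  assumes card: "CARD('n) \<ge> 2" and f: "lhol f Sh" and contf: "continuous_on Sh f"
  obtains F where "lhol F (ball 0 b)" "\<And>z. z \<in> Sh \<Longrightarrow> F z = f z"
proof (cases "0 \<le> a \<and> a < b")
  case False
  show ?thesis
  \<comment> \<open>For negative \<open>a\<close> the shell is a full ball and there is nothing to
    extend; the innermost shell of the perforated ball is of this kind.\<close>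
  proof (cases "a < 0")
    case True
    then have "Sh = ball 0 b" unfolding Sh_def by (auto intro: less_le_trans)
    then show ?thesis using f that by auto
  next
    case False
    with \<open>\<not> (0 \<le> a \<and> a < b)\<close> have "Sh = {}" unfolding Sh_def by auto
    then show ?thesis using that[of "\<lambda>_. 0"] by (auto simp: lhol_def)
  qed
next
  case True
  then have a: "0 \<le> a" and ab: "a < b" by auto
  obtain i j :: 'n where ij: "i \<noteq> j"
    \<comment> \<open>The dimension enters here: \<open>i\<close> is the direction of integration,
      \<open>j\<close> supplies points around which the whole disc in direction \<open>i\<close>
      stays in the shell.\<close>
    by (metis card_le_Suc0_iff_eq finite UNIV_I card not_less_eq_eq numeral_2_eq_2)
  define e :: "complex ^ 'n" where "e = axis i 1"
  define \<pi> :: "complex ^ 'n \<Rightarrow> complex ^ 'n" where "\<pi> = (\<lambda>z. z - z $ i *s e)"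
  have e: "norm e = 1" by (simp add: e_def norm_axis)
  have orth: "herm (\<pi> z) e = 0" for z
    unfolding herm_def by (rule sum.neutral) (simp add: \<pi>_def e_def axis_def)
  have split: "z = \<pi> z + z $ i *s e" for z by (simp add: \<pi>_def)
  have nsl: "(norm (\<pi> z + t *s e))\<^sup>2 = (norm (\<pi> z))\<^sup>2 + (cmod t)\<^sup>2" for z t
    by (rule norm_sq_orthogonal_line[OF orth e])
  have nsp: "(norm z)\<^sup>2 = (norm (\<pi> z))\<^sup>2 + (cmod (z $ i))\<^sup>2" for z
    using nsl[of z "z $ i"] split[of z] by metis
  have \<pi>line: "\<pi> (p + t *s v) = \<pi> p + t *s \<pi> v" for p t v
    by (simp add: \<pi>_def vec_eq_iff algebra_simps)
  have cont\<pi>: "continuous_on S \<pi>" for S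
    unfolding \<pi>_def by (intro continuous_intros bounded_linear.continuous_on[OF bounded_linear_vscale])
  have Sh_iff: "\<pi> z + t *s e \<in> Sh \<longleftrightarrow> a\<^sup>2 < (norm (\<pi> z))\<^sup>2 + (cmod t)\<^sup>2 \<and> (norm (\<pi> z))\<^sup>2 + (cmod t)\<^sup>2 < b\<^sup>2"
    for z t
    using a ab less_sq[of a "norm (\<pi> z + t *s e)"] less_sq[of "norm (\<pi> z + t *s e)" b]
    unfolding Sh_def nsl[symmetric] by simp
  define adm where "adm R z \<longleftrightarrow> 0 < R \<and> cmod (z $ i) < R \<and>
    a\<^sup>2 < (norm (\<pi> z))\<^sup>2 + R\<^sup>2 \<and> (norm (\<pi> z))\<^sup>2 + R\<^sup>2 < b\<^sup>2" for R z
  define I where "I R z = contour_integral (circlepath 0 R) (\<lambda>t. f (\<pi> z + t *s e) / (t - z $ i))" for R z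
  define F where "F z = I (SOME R. adm R z) z / (2 * pi * \<i>)" for z
  have ex_adm: "\<exists>R. adm R z" if "norm z < b" for z
  proof -
    have "(norm z)\<^sup>2 < b\<^sup>2" "a\<^sup>2 < b\<^sup>2" using that a ab by (simp_all add: less_sq)
    \<comment> \<open>\<open>m\<close> will be the square of the radius; the lower bounds make the
      circle enclose \<open>z $ i\<close> and stay outside the inner sphere.\<close>
    then have "max ((cmod (z $ i))\<^sup>2) (a\<^sup>2 - (norm (\<pi> z))\<^sup>2) < b\<^sup>2 - (norm (\<pi> z))\<^sup>2"
      unfolding nsp[of z] by simp
    then obtain m where m: "max ((cmod (z $ i))\<^sup>2) (a\<^sup>2 - (norm (\<pi> z))\<^sup>2) < m" "m < b\<^sup>2 - (norm (\<pi> z))\<^sup>2"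
      using dense by blast
    then have "0 < m" by (metis max_less_iff_conj order_le_less_trans zero_le_power2)
    with m have "adm (sqrt m) z"
      unfolding adm_def by (auto intro: real_less_rsqrt)
    then show ?thesis ..
  qed
  have I_indep: "I R z = I R' z" if R: "adm R z" and R': "adm R' z" for R R' z
  proof -
    define S where "S = {t. \<pi> z + t *s e \<in> Sh} - {z $ i}"
    have oSh: "open Sh" unfolding Sh_def by (intro open_Collect_conj open_Collect_less continuous_intros)
    have S: "t \<in> S" if "min R R' \<le> cmod t" "cmod t \<le> max R R'" for t
    proof -
      have "(min R R')\<^sup>2 \<le> (cmod t)\<^sup>2" "(cmod t)\<^sup>2 \<le> (max R R')\<^sup>2"
        using that R R' by (auto simp: adm_def intro!: power_mono)
      moreover have "a\<^sup>2 < (norm (\<pi> z))\<^sup>2 + (min R R')\<^sup>2" "(norm (\<pi> z))\<^sup>2 + (max R R')\<^sup>2 < b\<^sup>2"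
        using R R' by (auto simp: adm_def min_def max_def)
      ultimately have "\<pi> z + t *s e \<in> Sh" unfolding Sh_iff by linarith
      moreover have "t \<noteq> z $ i" using that R R' by (auto simp: adm_def)
      ultimately show ?thesis by (simp add: S_def)
    qed
    \<comment> \<open>Equal parameters on the two circles have equal arguments, so the homotopy is
      radial and passes only through moduli between \<open>R\<close> and \<open>R'\<close>.\<close>
    have seg: "closed_segment (circlepath 0 R t) (circlepath 0 R' t) \<subseteq> S" for t
    proof
      fix x assume "x \<in> closed_segment (circlepath 0 R t) (circlepath 0 R' t)"
      then obtain u where u: "0 \<le> u" "u \<le> 1"
        "x = (1 - u) *\<^sub>R circlepath 0 R t + u *\<^sub>R circlepath 0 R' t"
        by (auto simp: closed_segment_def)
      define w where "w = (1 - u) * R + u * R'"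
      have "x = of_real w * exp (2 * of_real pi * \<i> * of_real t)"
        unfolding u(3) w_def circlepath by (simp add: scaleR_conv_of_real algebra_simps)
      then have "cmod x = \<bar>w\<bar>" by (simp add: norm_mult)
      moreover have "min R R' \<le> w" "w \<le> max R R'"
        using convex_bound_le[of R "max R R'" R' "1 - u" u] convex_bound_le[of "- R" "- min R R'" "- R'" "1 - u" u] u
        by (auto simp: w_def algebra_simps)
      moreover have "0 < min R R'" using R R' by (auto simp: adm_def)
      ultimately show "x \<in> S" by (intro S) auto
    qed
    have "homotopic_loops S (circlepath 0 R) (circlepath 0 R')"
      by (rule homotopic_loops_linear) (use seg in auto)
    moreover have "(\<lambda>t. f (\<pi> z + t *s e) / (t - z $ i)) holomorphic_on S"
      by (intro holomorphic_intros lholD[OF f]) (auto simp: S_def)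
    ultimately show ?thesis
      unfolding I_def using open_line_slice[OF oSh, of "\<pi> z" e]
      by (intro Cauchy_theorem_homotopic_loops[where S = S]) (auto simp: S_def)
  qed
  have F_eq: "F z = I R z / (2 * pi * \<i>)" if "adm R z" for R z
    unfolding F_def using I_indep[OF someI[of "\<lambda>R. adm R z", OF that] that] by simp
  \<comment> \<open>A radius admissible for \<open>z\<close> is admissible nearby. Hence
    \<open>F\<close> is locally a single integral \<open>I R\<close>, although the choice of the
    radius in its definition may jump.\<close>
  have open_adm: "open {z. adm R z}" for R
    unfolding adm_def by (intro open_Collect_conj open_Collect_less continuous_intros cont\<pi>)
  have lhol_I: "lhol (I R) {z. adm R z}" for R
    unfolding lhol_def
  proof (intro allI)
    fix p v
    show "(\<lambda>t. I R (p + t *s v)) holomorphic_on {t. p + t *s v \<in> {z. adm R z}}" (is "_ holomorphic_on ?T")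
    proof (cases "R > 0")
      case False
      then show ?thesis by (simp add: adm_def holomorphic_on_def)
    next
      case True
      have inSh: "\<pi> (p + x *s v) + t *s e \<in> Sh" if "x \<in> ?T" "t \<in> sphere 0 R" for x t
        using that unfolding Sh_iff by (simp add: adm_def)
      have ne: "t - (p + x *s v) $ i \<noteq> 0" if "x \<in> ?T" "t \<in> sphere 0 R" for x t
        using that by (auto simp: adm_def)
      show ?thesis
        unfolding I_def
      proof (rule holomorphic_on_circlepath_integral_param[OF open_line_slice[OF open_adm] True])
        have c1: "continuous_on (?T \<times> sphere 0 R) (\<lambda>y. \<pi> (p + fst y *s v) + snd y *s e)"
          unfolding \<pi>line
          by (intro continuous_intros bounded_linear.continuous_on[OF bounded_linear_vscale])
        have c2: "continuous_on (?T \<times> sphere 0 R) (\<lambda>y. f (\<pi> (p + fst y *s v) + snd y *s e))"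
          by (rule continuous_on_compose2[OF contf c1]) (use inSh in auto)
        have c3: "continuous_on (?T \<times> sphere 0 R) (\<lambda>y. snd y - (p + fst y *s v) $ i)"
          by (auto intro!: continuous_intros)
        have "continuous_on (?T \<times> sphere 0 R) (\<lambda>y. f (\<pi> (p + fst y *s v) + snd y *s e) / (snd y - (p + fst y *s v) $ i))"
          by (rule continuous_on_divide[OF c2 c3]) (use ne in auto)
        then show "continuous_on (?T \<times> sphere 0 R) (\<lambda>(x, t). f (\<pi> (p + x *s v) + t *s e) / (t - (p + x *s v) $ i))"
          by (simp only: case_prod_unfold)
      next
        fix t :: complex assume t: "t \<in> sphere 0 R"
        have eq: "\<pi> (p + x *s v) + t *s e = (\<pi> p + t *s e) + x *s \<pi> v" for x
          by (simp add: \<pi>line)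
        have "(\<lambda>x. f ((\<pi> p + t *s e) + x *s \<pi> v)) holomorphic_on ?T"
          by (rule lholD[OF f]) (use inSh[OF _ t] in \<open>simp only: eq\<close>)
        then have "(\<lambda>x. f (\<pi> (p + x *s v) + t *s e)) holomorphic_on ?T"
          by (simp only: eq)
        moreover have "(\<lambda>x. t - (p + x *s v) $ i) holomorphic_on ?T"
          by (auto intro!: holomorphic_intros)
        ultimately show "(\<lambda>x. f (\<pi> (p + x *s v) + t *s e) / (t - (p + x *s v) $ i)) holomorphic_on ?T"
          by (rule holomorphic_on_divide) (use ne[OF _ t] in blast)
      qed
    qed
  qed
  have lhol_F: "lhol F (ball 0 b)"
  proof (rule lhol_locally)
    fix z :: "complex ^ 'n" assume "z \<in> ball 0 b"
    then obtain R where R: "adm R z" using ex_adm by auto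
    have "lhol F {z. adm R z}"
      unfolding lhol_def
    proof (intro allI)
      fix p v
      have "(\<lambda>t. I R (p + t *s v) / (2 * pi * \<i>)) holomorphic_on {t. p + t *s v \<in> {z. adm R z}}"
        using lhol_I[of R] unfolding lhol_def by (intro holomorphic_intros) auto
      then show "(\<lambda>t. F (p + t *s v)) holomorphic_on {t. p + t *s v \<in> {z. adm R z}}"
        by (rule holomorphic_transform) (simp add: F_eq)
    qed
    then show "\<exists>T. open T \<and> z \<in> T \<and> lhol F T" using open_adm R by blast
  qed
  have oSh: "open Sh" unfolding Sh_def by (intro open_Collect_conj open_Collect_less continuous_intros)
  \<comment> \<open>On \<open>W\<close> the projection alone already has norm above
    \<open>a\<close>, so the disc bounded by an admissible circle lies in the shell and Cauchy's
    formula gives \<open>f\<close>.\<close>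
  define W where "W = {z \<in> Sh. a < norm (\<pi> z)}"
  have F_W: "F z = f z" if "z \<in> W" for z
  proof -
    have z: "norm z < b" "a < norm (\<pi> z)" using that by (auto simp: W_def Sh_def)
    obtain R where R: "adm R z" using ex_adm z by blast
    have "(\<lambda>t. f (\<pi> z + t *s e)) holomorphic_on cball 0 R"
    proof (rule lholD[OF f])
      fix t :: complex assume "t \<in> cball 0 R"
      then have "(cmod t)\<^sup>2 \<le> R\<^sup>2" by (simp add: power_mono)
      moreover have "a\<^sup>2 < (norm (\<pi> z))\<^sup>2" using z a by (simp add: less_sq)
      ultimately show "\<pi> z + t *s e \<in> Sh"
        unfolding Sh_iff using R zero_le_power2[of "cmod t"] unfolding adm_def by linarith
    qed
    from Cauchy_integral_circlepath_simple[OF this, of "z $ i"] R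
    have "I R z = 2 * pi * \<i> * f (\<pi> z + z $ i *s e)"
      unfolding I_def by (intro contour_integral_unique) (simp add: adm_def)
    then show ?thesis using F_eq[OF R] split[of z] by simp
  qed
  have "F z = f z" if "z \<in> Sh" for z
  proof (rule lhol_identity[of F Sh f W])
    show "lhol F Sh" by (rule lhol_subset[OF lhol_F]) (auto simp: Sh_def)
    show "connected {t. p + t *s v \<in> Sh}" for p v
      unfolding Sh_def by (rule connected_slice_shell)
    have "W = Sh \<inter> {z. a < norm (\<pi> z)}" by (auto simp: W_def)
    then show "open W" using oSh by (auto intro!: open_Collect_less continuous_intros cont\<pi>)
    define w :: "complex ^ 'n" where "w = axis j (of_real ((a + b) / 2))"
    have "\<pi> w = w" using ij by (simp add: \<pi>_def w_def axis_def)
    moreover have "norm w = (a + b) / 2"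
      unfolding w_def norm_axis norm_of_real using a ab by simp
    ultimately show "w \<in> W" using ab by (simp add: W_def Sh_def)
  qed (use f oSh F_W that in \<open>auto simp: W_def\<close>)
  then show ?thesis using that lhol_F by blast
qed

section \<open>Self-maps of the ball and of the disc\<close>

text \<open>On the disc of radius \<open>\<delta> = 1 - norm z\<close> in the line from
  \<open>z\<close> to \<open>w\<close>, a component of \<open>F\<close> differs from its value at
  \<open>z\<close> by less than 2. Divided by 3, the difference is a self-map of the disc vanishing
  at 0, and the Schwarz lemma gives the Lipschitz bound
  \<open>3 * norm (w - z) / \<delta>\<close>.\<close>

lemma lhol_continuous_on_ball:
  fixes F :: "complex ^ 'n \<Rightarrow> complex ^ 'n"
  assumes hol: "\<And>i. lhol (\<lambda>z. F z $ i) (ball 0 1)" and bd: "\<And>z. norm z < 1 \<Longrightarrow> norm (F z) < 1"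
  shows "continuous_on (ball 0 1) F"
proof -
  have "continuous_on (ball 0 1) (\<lambda>z. F z $ i)" for i
    unfolding continuous_on_iff
  proof (intro ballI allI impI)
    fix z :: "complex ^ 'n" and \<epsilon> :: real assume z: "z \<in> ball 0 1" and \<epsilon>: "\<epsilon> > 0"
    define \<delta> where "\<delta> = 1 - norm z"
    have \<delta>: "\<delta> > 0" using z by (simp add: \<delta>_def)
    have lip: "cmod (F w $ i - F z $ i) \<le> 3 * norm (w - z) / \<delta>" if w: "norm (w - z) < \<delta>" for w
    proof (cases "w = z")
      case False
      define N where "N = norm (w - z)"
      have N: "N > 0" using False by (simp add: N_def)
      define v where "v = complex_of_real (\<delta> / N) *s (w - z)"
      have v: "norm v = \<delta>"
        unfolding v_def norm_vscale norm_of_real using N \<delta> by (simp flip: N_def)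
      have inb: "norm (z + t *s v) < 1" if "cmod t < 1" for t
      proof -
        have "norm (z + t *s v) \<le> norm z + cmod t * \<delta>"
          using norm_triangle_ineq[of z "t *s v"] by (simp add: norm_vscale v)
        also have "\<dots> < norm z + 1 * \<delta>" using that \<delta> by simp
        finally show ?thesis by (simp add: \<delta>_def)
      qed
      define \<psi> where "\<psi> t = (F (z + t *s v) $ i - F z $ i) / 3" for t
      have "cmod (\<psi> (of_real (N / \<delta>))) \<le> cmod (of_real (N / \<delta>))"
      proof (rule Schwarz_Lemma(1))
        have "(\<lambda>t. F (z + t *s v) $ i) holomorphic_on ball 0 1"
          by (rule lholD[OF hol]) (simp add: inb)
        then show "\<psi> holomorphic_on ball 0 1"
          unfolding \<psi>_def by (intro holomorphic_intros) auto
        show "\<psi> 0 = 0" by (simp add: \<psi>_def)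
        show "cmod (\<psi> t) < 1" if t: "cmod t < 1" for t
        proof -
          have "cmod (F x $ i) < 1" if "norm x < 1" for x
            using bd[OF that] Finite_Cartesian_Product.norm_nth_le[of "F x" i] by linarith
          from this[OF inb[OF t]] this[of z] have "cmod (F (z + t *s v) $ i - F z $ i) < 2"
            using norm_triangle_ineq4[of "F (z + t *s v) $ i" "F z $ i"] z by simp
          then show ?thesis by (simp add: \<psi>_def norm_divide)
        qed
        show "cmod (of_real (N / \<delta>)) < 1" using w N \<delta> unfolding norm_of_real by (simp add: N_def)
      qed
      moreover have "z + complex_of_real (N / \<delta>) *s v = w"
      proof -
        have "complex_of_real (N / \<delta>) *s v = w - z"
          unfolding v_def vector_smult_assoc of_real_mult[symmetric] using N \<delta> by simp
        then show ?thesis by simp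
      qed
      ultimately have "cmod (F w $ i - F z $ i) \<le> 3 * cmod (of_real (N / \<delta>))"
        by (simp add: \<psi>_def norm_divide mult.commute)
      then show ?thesis using N \<delta> unfolding norm_of_real N_def[symmetric]
        by (simp add: abs_of_pos field_simps)
    qed simp
    show "\<exists>d>0. \<forall>w\<in>ball 0 1. dist w z < d \<longrightarrow> dist (F w $ i) (F z $ i) < \<epsilon>"
    proof (intro exI conjI ballI impI)
      show "min \<delta> (\<epsilon> * \<delta> / 3) > 0" using \<delta> \<epsilon> by simp
      fix w assume "dist w z < min \<delta> (\<epsilon> * \<delta> / 3)"
      then have w: "norm (w - z) < \<delta>" "3 * norm (w - z) / \<delta> < \<epsilon>"
        using \<delta> by (auto simp: dist_norm field_simps)
      then show "dist (F w $ i) (F z $ i) < \<epsilon>" using lip[OF w(1)] by (simp add: dist_norm)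
    qed
  qed
  then have "continuous_on (ball 0 1) (\<lambda>z. \<chi> i. F z $ i)"
    by (intro continuous_on_vec_lambda)
  then show ?thesis by simp
qed

text \<open>A Moebius map moves \<open>a\<close> to 0. The other fixed point then gives equality in
  the Schwarz lemma, so the conjugated map is a rotation with a nonzero fixed point.\<close>

lemma holomorphic_two_fixed_points_disc:
  assumes H: "H holomorphic_on ball 0 1" and H1: "\<And>z. cmod z < 1 \<Longrightarrow> cmod (H z) < 1"
    and ab: "cmod a < 1" "cmod b < 1" "a \<noteq> b" "H a = a" "H b = b" and z: "cmod z < 1"
  shows "H z = z"
proof -
  let ?M = "Moebius_function 0 a" and ?N = "Moebius_function 0 (- a)"
  have M1: "cmod (?M x) < 1" and N1: "cmod (?N x) < 1" if "cmod x < 1" for x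
    using Moebius_function_norm_lt_1 ab(1) that by simp_all
  have NM: "?N (?M x) = x" and MN: "?M (?N x) = x" if "cmod x < 1" for x
    using Moebius_function_compose ab(1) that by simp_all
  have N0: "?N 0 = a" by (simp add: Moebius_function_of_zero)
  define G where "G = ?M \<circ> (H \<circ> ?N)"
  have "?N holomorphic_on ball 0 1" using ab(1) by (intro Moebius_function_holomorphic) simp
  then have "H \<circ> ?N holomorphic_on ball 0 1"
    by (rule holomorphic_on_compose_gen[OF _ H]) (simp add: image_subset_iff N1)
  then have G: "G holomorphic_on ball 0 1"
    unfolding G_def by (rule holomorphic_on_compose_gen[OF _ Moebius_function_holomorphic[OF ab(1)]])
      (simp add: image_subset_iff N1 H1)
  have G0: "G 0 = 0" using ab by (simp add: G_def N0 Moebius_function_eq_zero)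
  have G1: "cmod (G x) < 1" if "cmod x < 1" for x
    using that by (simp add: G_def M1 N1 H1)
  define \<beta> where "\<beta> = ?M b"
  have \<beta>: "cmod \<beta> < 1" unfolding \<beta>_def by (rule M1[OF ab(2)])
  have "\<beta> \<noteq> 0" using NM[OF ab(2)] N0 ab(3) unfolding \<beta>_def by metis
  have "G \<beta> = \<beta>" unfolding \<beta>_def G_def by (simp add: NM[OF ab(2)] ab(5))
  with \<beta> \<open>\<beta> \<noteq> 0\<close> have "\<exists>z. cmod z < 1 \<and> z \<noteq> 0 \<and> cmod (G z) = cmod z" by metis
  then obtain \<alpha> where \<alpha>: "\<And>x. cmod x < 1 \<Longrightarrow> G x = \<alpha> * x"
    using Schwarz_Lemma(3)[OF G G0 G1, of 0] by auto
  have "\<alpha> = 1" using \<alpha>[OF \<beta>] \<open>\<beta> \<noteq> 0\<close> \<open>G \<beta> = \<beta>\<close> by simp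
  then have "?M (H z) = ?M z"
    using \<alpha>[OF M1[OF z]] by (simp add: G_def NM z)
  then show ?thesis using NM[OF z] NM[OF H1[OF z]] by simp
qed

text \<open>The maximum principle on the disc of radius \<open>r\<close> bounds \<open>g w\<close>
  by the values on its rim, which tend to 0 as \<open>r\<close> tends to 1.\<close>

lemma holomorphic_zero_if_small_at_boundary:
  assumes g: "g holomorphic_on ball 0 1"
    and le: "\<And>z. cmod z < 1 \<Longrightarrow> (cmod (g z))\<^sup>2 \<le> C * (1 - (cmod z)\<^sup>2)" and w: "cmod w < 1"
  shows "g w = 0"
proof -
  have bound: "(cmod (g w))\<^sup>2 \<le> C * (1 - r\<^sup>2)" if r: "cmod w < r" "r < 1" for r
  proof -
    have r0: "0 < r" using r norm_ge_zero[of w] by linarith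
    have nn: "0 \<le> C * (1 - r\<^sup>2)"
      using order_trans[OF zero_le_power2 le[of "of_real r"]] r r0 by simp
    have "cmod (g w) \<le> sqrt (C * (1 - r\<^sup>2))"
    proof (rule maximum_modulus_frontier[of g "cball 0 r"])
      show "g holomorphic_on interior (cball 0 r)"
        using r by (intro holomorphic_on_subset[OF g]) auto
      show "continuous_on (closure (cball 0 r)) g"
        using r by (intro continuous_on_subset[OF holomorphic_on_imp_continuous_on[OF g]]) auto
      show "cmod (g z) \<le> sqrt (C * (1 - r\<^sup>2))" if "z \<in> frontier (cball 0 r)" for z
        using le[of z] that r r0 by (auto intro!: real_le_rsqrt)
    qed (use r r0 in auto)
    then have "(cmod (g w))\<^sup>2 \<le> (sqrt (C * (1 - r\<^sup>2)))\<^sup>2" by (rule power_mono) simp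
    then show ?thesis using nn by simp
  qed
  have "((\<lambda>r. C * (1 - r\<^sup>2)) \<longlongrightarrow> C * (1 - 1\<^sup>2)) (at_left (1::real))"
    by (intro tendsto_intros)
  moreover have "eventually (\<lambda>r. (cmod (g w))\<^sup>2 \<le> C * (1 - r\<^sup>2)) (at_left 1)"
    using eventually_at_left_real[OF w] by eventually_elim (use bound in auto)
  ultimately have "(cmod (g w))\<^sup>2 \<le> C * (1 - 1\<^sup>2)"
    by (intro tendsto_lowerbound[of "\<lambda>r. C * (1 - r\<^sup>2)" _ "at_left (1::real)"]) auto
  then show ?thesis by simp
qed

text \<open>The difference of the two sides is the squared modulus of
  \<open>herm w c - (norm c)^2\<close>. The term \<open>(norm (w - c))^2\<close> measures the
  distance from the line and is what finally forces the transversal part to be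
  \<open>c\<close>.\<close>

lemma herm_ball_inequality:
  "(1 - (norm c)\<^sup>2) * (1 - (norm w)\<^sup>2 + (norm (w - c))\<^sup>2) \<le> (cmod (1 - herm w c))\<^sup>2"
proof -
  define x where "x = herm w c"
  have "(cmod (1 - x))\<^sup>2 - (1 - (norm c)\<^sup>2) * (1 - (norm w)\<^sup>2 + (norm (w - c))\<^sup>2)
      = (Re x - (norm c)\<^sup>2)\<^sup>2 + (Im x)\<^sup>2"
    unfolding norm_sq_diff x_def[symmetric] cmod_power2 by (simp add: power2_eq_square algebra_simps)
  also have "\<dots> \<ge> 0" by simp
  finally show ?thesis by (simp add: x_def)
qed

text \<open>Composing with the holomorphic retraction of the ball onto the line gives a self-map of
  the disc with two fixed points; equality in the Schwarz lemma then forces the components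
  transversal to the line to vanish at the boundary.\<close>

lemma ball_self_map_fixes_line:
  fixes F :: "complex ^ 'n \<Rightarrow> complex ^ 'n"
  assumes hol: "\<And>i. lhol (\<lambda>z. F z $ i) (ball 0 1)" and bd: "\<And>z. norm z < 1 \<Longrightarrow> norm (F z) < 1"
    and u: "norm u = 1" "herm c u = 0"
    and s: "norm (c + s *s u) < 1" "F (c + s *s u) = c + s *s u"
    and t: "norm (c + t *s u) < 1" "F (c + t *s u) = c + t *s u" and st: "s \<noteq> t"
    and x: "norm (c + x *s u) < 1"
  shows "F (c + x *s u) = c + x *s u"
proof -
  have nl: "(norm (c + y *s u))\<^sup>2 = (norm c)\<^sup>2 + (cmod y)\<^sup>2" for y
    by (rule norm_sq_orthogonal_line[OF u(2,1)])
  have lt1: "norm (c + y *s u) < 1 \<longleftrightarrow> (norm c)\<^sup>2 + (cmod y)\<^sup>2 < 1" for y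
    using less_sq[of "norm (c + y *s u)" 1] by (simp add: nl)
  \<comment> \<open>\<open>\<rho>\<close> is the radius of the disc that the line cuts from the
    ball; \<open>\<phi>\<close> is \<open>F\<close> on that disc, rescaled to the unit disc.\<close>
  define \<rho> where "\<rho> = sqrt (1 - (norm c)\<^sup>2)"
  have c1: "(norm c)\<^sup>2 < 1" using s(1) unfolding lt1 by (metis add.commute add_increasing2 not_le zero_le_power2)
  have \<rho>: "\<rho> > 0" "\<rho>\<^sup>2 = 1 - (norm c)\<^sup>2" using c1 by (simp_all add: \<rho>_def)
  have nc: "norm c < 1" using c1 less_sq[of "norm c" 1] by simp
  have lt\<rho>: "norm (c + (of_real \<rho> * y) *s u) < 1 \<longleftrightarrow> cmod y < 1" for y
  proof -
    have "norm (c + (of_real \<rho> * y) *s u) < 1 \<longleftrightarrow> \<rho>\<^sup>2 * (cmod y)\<^sup>2 < \<rho>\<^sup>2 * 1"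
      unfolding lt1 using \<rho> by (simp add: norm_mult power_mult_distrib) linarith
    also have "\<dots> \<longleftrightarrow> cmod y < 1" using \<rho>(1) less_sq[of "cmod y" 1] by simp
    finally show ?thesis .
  qed
  define \<phi> where "\<phi> z = F (c + (of_real \<rho> * z) *s u)" for z
  have \<phi>1: "norm (\<phi> z) < 1" if "cmod z < 1" for z
    unfolding \<phi>_def using bd lt\<rho> that by simp
  have \<phi>hol: "(\<lambda>z. \<phi> z $ i) holomorphic_on ball 0 1" for i
  proof -
    have "(\<lambda>z. F (c + z *s (of_real \<rho> *s u)) $ i) holomorphic_on ball 0 1"
      using lt\<rho> by (intro lholD[OF hol]) (simp add: mult.commute)
    then show ?thesis unfolding \<phi>_def by (simp add: mult.commute)
  qed
  have hermhol: "(\<lambda>z. herm (\<phi> z) d) holomorphic_on ball 0 1" for d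
    unfolding herm_def by (intro holomorphic_intros \<phi>hol)
  define y where "y z = herm (\<phi> z) u" for z
  define w where "w z = \<phi> z - y z *s u" for z
  have uc: "herm u c = 0" using cnj_herm[of c u] u(2) by simp
  have xw: "herm (w z) c = herm (\<phi> z) c" for z
    by (simp add: w_def herm_diff_left herm_scale_left uc)
  have wu: "herm (w z) u = 0" for z
    by (simp add: w_def herm_diff_left herm_scale_left herm_self u y_def)
  have split: "\<phi> z = w z + y z *s u" for z by (simp add: w_def)
  have n\<phi>: "(norm (\<phi> z))\<^sup>2 = (norm (w z))\<^sup>2 + (cmod (y z))\<^sup>2" for z
    using norm_sq_orthogonal_line[OF wu u(1), of z "y z"] by (simp flip: split)
  have x1: "cmod (herm (\<phi> z) c) < 1" if "cmod z < 1" for z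
  proof -
    have "norm (\<phi> z) * norm c < 1 * 1"
      using \<phi>1[OF that] nc by (intro mult_strict_mono) auto
    then show ?thesis using norm_herm_le[of "\<phi> z" c] by linarith
  qed
  have x_ne: "1 - herm (\<phi> z) c \<noteq> 0" if "cmod z < 1" for z
    using x1[OF that] by auto
  have key: "\<rho>\<^sup>2 * (norm (w z - c))\<^sup>2 \<le> (cmod (1 - herm (\<phi> z) c))\<^sup>2 - \<rho>\<^sup>2 * (cmod (y z))\<^sup>2"
    and key': "\<rho>\<^sup>2 * (cmod (y z))\<^sup>2 < (cmod (1 - herm (\<phi> z) c))\<^sup>2" if z: "cmod z < 1" for z
  proof -
    have "(norm (\<phi> z))\<^sup>2 < 1\<^sup>2" using \<phi>1[OF z] by (subst less_sq) auto
    then have "\<rho>\<^sup>2 * (cmod (y z))\<^sup>2 < \<rho>\<^sup>2 * (1 - (norm (w z))\<^sup>2)"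
      unfolding n\<phi> using \<rho>(1) by simp
    moreover have "\<rho>\<^sup>2 * (1 - (norm (w z))\<^sup>2) + \<rho>\<^sup>2 * (norm (w z - c))\<^sup>2 \<le> (cmod (1 - herm (\<phi> z) c))\<^sup>2"
      using herm_ball_inequality[of c "w z"] unfolding xw \<rho>(2) by (simp only: distrib_left)
    moreover have "0 \<le> \<rho>\<^sup>2 * (norm (w z - c))\<^sup>2" by simp
    ultimately show "\<rho>\<^sup>2 * (norm (w z - c))\<^sup>2 \<le> (cmod (1 - herm (\<phi> z) c))\<^sup>2 - \<rho>\<^sup>2 * (cmod (y z))\<^sup>2"
      "\<rho>\<^sup>2 * (cmod (y z))\<^sup>2 < (cmod (1 - herm (\<phi> z) c))\<^sup>2" by linarith+
  qed
  \<comment> \<open>Up to sign this is the \<open>u\<close>-component after the ball automorphism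
    exchanging \<open>c\<close> and 0. On a point \<open>c + (\<rho> * z) *s u\<close> of the line
    it gives back \<open>z\<close>.\<close>
  define H where "H z = of_real \<rho> * y z / (1 - herm (\<phi> z) c)" for z
  have Hfix: "H (r / of_real \<rho>) = r / of_real \<rho>" "cmod (r / of_real \<rho>) < 1"
    if r: "norm (c + r *s u) < 1" "F (c + r *s u) = c + r *s u" for r
  proof -
    have "\<phi> (r / of_real \<rho>) = c + r *s u" using r \<rho> by (simp add: \<phi>_def)
    then have "H (r / of_real \<rho>) = of_real \<rho> * r / of_real (\<rho>\<^sup>2)"
      unfolding H_def y_def \<rho>(2) by (simp add: herm_add_left herm_scale_left herm_self u uc)
    also have "\<dots> = r / of_real \<rho>" using \<rho>(1) by (simp add: power2_eq_square)
    finally show "H (r / of_real \<rho>) = r / of_real \<rho>" .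
    show "cmod (r / of_real \<rho>) < 1" using r(1) lt\<rho>[of "r / of_real \<rho>"] \<rho>(1) by simp
  qed
  have Hz: "H z = z" if z: "cmod z < 1" for z
  proof (rule holomorphic_two_fixed_points_disc[of H "s / of_real \<rho>" "t / of_real \<rho>"])
    show "H holomorphic_on ball 0 1"
      unfolding H_def y_def using x_ne by (intro holomorphic_intros hermhol) auto
    show "cmod (H z) < 1" if "cmod z < 1" for z
    proof -
      have "\<rho> * cmod (y z) < cmod (1 - herm (\<phi> z) c)"
        using key'[OF that] \<rho>(1) less_sq[of "\<rho> * cmod (y z)" "cmod (1 - herm (\<phi> z) c)"]
        by (simp add: power_mult_distrib)
      then show ?thesis
        using x_ne[OF that] \<rho>(1) by (simp add: H_def norm_divide norm_mult divide_less_eq)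
    qed
  qed (use Hfix s t st z \<rho> in auto)
  have yz: "of_real \<rho> * y z = z * (1 - herm (\<phi> z) c)" if "cmod z < 1" for z
    using Hz[OF that] x_ne[OF that] by (simp add: H_def divide_eq_eq)
  have wc: "w z = c" if z: "cmod z < 1" for z
  proof -
    have "(w z - c) $ i = 0" for i
    \<comment> \<open>Since \<open>H\<close> is the identity, \<open>\<rho> * cmod (y z)\<close>
      equals \<open>cmod z * X\<close>, so \<open>key\<close> leaves only
      \<open>(1 - (cmod z)^2) * X^2\<close>; the 4 comes from \<open>X \<le> 2\<close>.\<close>
    proof (rule holomorphic_zero_if_small_at_boundary[where C = "4 / \<rho>\<^sup>2" and g = "\<lambda>z. (w z - c) $ i", OF _ _ z])
      show "(\<lambda>z. (w z - c) $ i) holomorphic_on ball 0 1"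
        unfolding w_def y_def by (simp, intro holomorphic_intros \<phi>hol hermhol)
      fix z assume z: "cmod z < 1"
      define X where "X = cmod (1 - herm (\<phi> z) c)"
      have "X \<le> 2" using x1[OF z] norm_triangle_ineq4[of 1 "herm (\<phi> z) c"] by (simp add: X_def)
      then have X4: "X\<^sup>2 \<le> 4" using power_mono[of X 2 2] by (simp add: X_def)
      have "\<rho>\<^sup>2 * (cmod (y z))\<^sup>2 = (cmod z)\<^sup>2 * X\<^sup>2"
        using arg_cong[OF yz[OF z], of "\<lambda>a. (cmod a)\<^sup>2"] by (simp add: norm_mult power_mult_distrib X_def)
      then have "\<rho>\<^sup>2 * (norm (w z - c))\<^sup>2 \<le> (1 - (cmod z)\<^sup>2) * X\<^sup>2"
        using key[OF z] by (simp add: X_def algebra_simps)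
      also have "\<dots> \<le> (1 - (cmod z)\<^sup>2) * 4"
        using X4 z by (intro mult_left_mono) (simp_all add: power_le_one)
      finally have "(norm (w z - c))\<^sup>2 \<le> 4 / \<rho>\<^sup>2 * (1 - (cmod z)\<^sup>2)"
        using \<rho>(1) by (simp add: pos_le_divide_eq mult.commute)
      moreover have "(cmod ((w z - c) $ i))\<^sup>2 \<le> (norm (w z - c))\<^sup>2"
        by (rule power_mono[OF Finite_Cartesian_Product.norm_nth_le]) simp
      ultimately show "(cmod ((w z - c) $ i))\<^sup>2 \<le> 4 / \<rho>\<^sup>2 * (1 - (cmod z)\<^sup>2)" by linarith
    qed
    then show ?thesis by (simp add: vec_eq_iff)
  qed
  define z where "z = x / of_real \<rho>"
  have x\<rho>: "x = of_real \<rho> * z" using \<rho>(1) by (simp add: z_def)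
  have z: "cmod z < 1" using x unfolding x\<rho> lt\<rho> .
  have "herm (\<phi> z) c = of_real ((norm c)\<^sup>2)" using xw[of z] wc[OF z] by (simp add: herm_self)
  then have "of_real \<rho> * y z = z * of_real (\<rho>\<^sup>2)"
    using yz[OF z] unfolding \<rho>(2) of_real_diff of_real_1 by metis
  also have "\<dots> = of_real \<rho> * x"
    unfolding x\<rho> by (simp add: power2_eq_square)
  finally have "of_real \<rho> * y z = of_real \<rho> * x" .
  then have "y z = x" using \<rho>(1) by simp
  then show ?thesis
    using split[of z] wc[OF z] unfolding \<phi>_def x\<rho>[symmetric] by simp
qed

section \<open>Norms of vector-valued functions on circles\<close>

lemma circle_islimpt:
  fixes z :: complex
  assumes r: "r > 0" and z: "cmod z = r" and A: "open A" "z \<in> A"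
  shows "z islimpt (A \<inter> sphere 0 r)"
proof -
  have "z islimpt sphere 0 r"
  proof (rule connected_imp_perfect)
    show "connected (sphere (0::complex) r)" by (rule connected_sphere) simp
    have "of_real r \<in> sphere (0::complex) r" "- of_real r \<in> sphere (0::complex) r" using r by auto
    moreover have "(of_real r :: complex) \<noteq> - of_real r" using r by simp
    ultimately show "sphere 0 r \<noteq> {x}" for x :: complex by (metis singletonD)
  qed (use z in auto)
  then show ?thesis
    using A unfolding islimpt_def by (metis IntE IntI open_Int)
qed

text \<open>Schwarz reflection: on the circle of radius \<open>s\<close>, \<open>s\<^sup>2 / cnj t = t\<close>, so the function below
  equals the squared norm of \<open>\<phi>\<close> there and is holomorphic nearby.\<close>

lemma norm_const_on_circle:
  fixes \<phi> :: "complex \<Rightarrow> complex ^ 'n"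
  assumes hol: "\<And>i. (\<lambda>t. \<phi> t $ i) holomorphic_on ball 0 b" and s: "0 < s" "s < b"
    and A: "open A" "w \<in> A" "cmod w = s" and eq: "\<And>t. t \<in> A \<Longrightarrow> cmod t = s \<Longrightarrow> norm (\<phi> t) = r"
    and t: "cmod t = s"
  shows "norm (\<phi> t) = r"
proof -
  \<comment> \<open>This annulus is invariant under the reflection \<open>s^2 / cnj t\<close>, which
    exchanges its two boundary circles and maps it into the disc where \<open>\<phi>\<close> is
    holomorphic.\<close>
  define T where "T = {t::complex. s\<^sup>2 / b < norm (t - 0) \<and> norm (t - 0) < b}"
  have oT: "open T" unfolding T_def by (intro open_Collect_conj open_Collect_less continuous_intros)
  have cT: "connected T" unfolding T_def by (rule connected_annulus) simp
  have sb: "s\<^sup>2 / b < s" using s by (simp add: divide_less_eq power2_eq_square)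
  have T0: "0 < cmod t" "cmod t < b" "s\<^sup>2 / cmod t < b" if "t \<in> T" for t
  proof -
    have "s\<^sup>2 / b > 0" using s by simp
    then show "0 < cmod t" "cmod t < b" using that by (auto simp: T_def)
    then show "s\<^sup>2 / cmod t < b" using that s by (auto simp: T_def field_simps)
  qed
  define \<psi> where "\<psi> t = (\<Sum>i\<in>UNIV. \<phi> t $ i * cnj (\<phi> (of_real (s\<^sup>2) / cnj t) $ i))" for t
  have "(\<lambda>t. cnj (\<phi> (of_real (s\<^sup>2) / cnj t) $ i)) holomorphic_on T" for i
  proof -
    have cnjT: "cnj ` T = T"
    proof -
      have "cnj x \<in> T \<longleftrightarrow> x \<in> T" for x by (simp add: T_def)
      then show ?thesis by (force simp: image_iff)
    qed
    have "(\<lambda>t. \<phi> t $ i) \<circ> (\<lambda>t. of_real (s\<^sup>2) / t) holomorphic_on T"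
    proof (rule holomorphic_on_compose_gen[OF _ hol])
      show "(\<lambda>t. complex_of_real (s\<^sup>2) / t) holomorphic_on T"
        using T0(1) by (intro holomorphic_intros) auto
      show "(\<lambda>t. complex_of_real (s\<^sup>2) / t) ` T \<subseteq> ball 0 b"
        using T0(3) by (auto simp: norm_divide norm_power)
    qed
    \<comment> \<open>Conjugating both argument and value turns the antiholomorphic reflection into
      a holomorphic function.\<close>
    then have "cnj \<circ> ((\<lambda>t. \<phi> t $ i) \<circ> (\<lambda>t. of_real (s\<^sup>2) / t)) \<circ> cnj holomorphic_on T"
      by (intro holomorphic_on_compose_cnj_cnj oT) (simp only: cnjT)
    then show ?thesis by (simp only: o_def)
  qed
  moreover have "(\<lambda>t. \<phi> t $ i) holomorphic_on T" for i
    using T0(2) by (intro holomorphic_on_subset[OF hol]) auto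
  ultimately have \<psi>hol: "\<psi> holomorphic_on T"
    unfolding \<psi>_def by (intro holomorphic_intros)
  have \<psi>s: "\<psi> t = of_real ((norm (\<phi> t))\<^sup>2)" if "cmod t = s" for t
  proof -
    have "of_real (s\<^sup>2) / cnj t = t"
      using complex_norm_square[of t] that s(1) by (auto simp: divide_eq_eq)
    then show ?thesis using herm_self[of "\<phi> t"] by (simp only: \<psi>_def herm_def)
  qed
  have sphT: "t \<in> T" if "cmod t = s" for t using that s sb by (simp add: T_def)
  have "\<psi> constant_on T"
  proof (rule analytic_continuation'[OF \<psi>hol oT cT])
    show "A \<inter> sphere 0 s \<subseteq> T" using sphT by auto
    show "w \<in> T" using sphT A by simp
    show "w islimpt (A \<inter> sphere 0 s)" by (rule circle_islimpt[OF s(1) A(3,1,2)])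
    show "\<psi> constant_on (A \<inter> sphere 0 s)"
      unfolding constant_on_def using \<psi>s eq by (intro exI[of _ "of_real (r\<^sup>2)"]) auto
  qed
  then have "\<psi> t = \<psi> w"
    unfolding constant_on_def using sphT[OF t] sphT[OF A(3)] by metis
  then have "(norm (\<phi> t))\<^sup>2 = (norm (\<phi> w))\<^sup>2" unfolding \<psi>s[OF t] \<psi>s[OF A(3)] of_real_eq_iff .
  then have "norm (\<phi> t) = norm (\<phi> w)" by (rule power2_eq_imp_eq) auto
  then show ?thesis using eq[OF A(2,3)] by simp
qed

text \<open>The quotient \<open>\<kappa>\<close> has modulus at most 1 on the outer two circles and
  the value 1 at a point of the middle one, so it is constant on the annulus. Since
  \<open>\<phi> 0 = 0\<close> is not known beforehand, \<open>\<kappa>\<close> may have a pole at 0;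
  a disc in place of the annulus would not do, hence three circles.\<close>

lemma linear_of_norm_on_three_circles:
  fixes \<phi> :: "complex \<Rightarrow> complex ^ 'n"
  assumes hol: "\<And>i. (\<lambda>t. \<phi> t $ i) holomorphic_on ball 0 1"
    and r: "0 < r1" "r1 < r2" "r2 < r3" "r3 < 1"
    and eq: "\<And>t. cmod t \<in> {r1, r2, r3} \<Longrightarrow> norm (\<phi> t) = cmod t"
  obtains a where "\<And>t. cmod t < 1 \<Longrightarrow> \<phi> t = t *s a"
proof -
  define S where "S = {t::complex. r1 < norm (t - 0) \<and> norm (t - 0) < r3}"
  have oS: "open S" unfolding S_def by (intro open_Collect_conj open_Collect_less continuous_intros)
  have cS: "connected S" unfolding S_def by (rule connected_annulus) simp
  have "closed {t::complex. r1 \<le> cmod t \<and> cmod t \<le> r3}"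
    by (intro closed_Collect_conj closed_Collect_le continuous_intros)
  then have clS: "closure S \<subseteq> {t. r1 \<le> cmod t \<and> cmod t \<le> r3}"
    by (intro closure_minimal) (auto simp: S_def)
  define z2 where "z2 = complex_of_real r2"
  have z2: "cmod z2 = r2" using r by (simp add: z2_def)
  have z20: "z2 \<noteq> 0" using r by (simp add: z2_def)
  have z2S: "z2 \<in> S" using z2 r by (simp add: S_def)
  define a where "a = (1 / z2) *s \<phi> z2"
  have a: "norm a = 1" unfolding a_def norm_vscale using eq[of z2] z2 z20 r by (simp add: norm_divide)
  define \<kappa> where "\<kappa> t = herm (\<phi> t) a / t" for t
  have \<kappa>hol: "\<kappa> holomorphic_on {t. r1 \<le> cmod t \<and> cmod t \<le> r3}"
    unfolding \<kappa>_def herm_def using r by (intro holomorphic_intros holomorphic_on_subset[OF hol]) auto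
  have \<kappa>le: "cmod (\<kappa> t) \<le> 1" if "t \<in> S" for t
  proof (rule maximum_modulus_frontier[of \<kappa> S])
    show "\<kappa> holomorphic_on interior S"
      by (rule holomorphic_on_subset[OF \<kappa>hol]) (use oS in \<open>auto simp: interior_open S_def\<close>)
    show "continuous_on (closure S) \<kappa>"
      by (rule continuous_on_subset[OF holomorphic_on_imp_continuous_on[OF \<kappa>hol] clS])
    show "bounded S" by (rule boundedI[of _ r3]) (auto simp: S_def)
    fix t assume "t \<in> frontier S"
    then have "t \<in> closure S" "t \<notin> S" using oS by (auto simp: frontier_def interior_open)
    then have "cmod t \<in> {r1, r2, r3}" "cmod t > 0" using clS r by (auto simp: S_def)
    then show "cmod (\<kappa> t) \<le> 1"
      using norm_herm_le[of "\<phi> t" a] eq[of t] a by (simp add: \<kappa>_def norm_divide)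
  qed (use that in auto)
  have \<kappa>z2: "\<kappa> z2 = 1"
  proof -
    have "\<kappa> z2 = herm a a" using z20 unfolding \<kappa>_def a_def by (simp add: herm_scale_left)
    then show ?thesis by (simp add: herm_self a)
  qed
  have "\<kappa> constant_on S"
    by (rule maximum_modulus_principle[OF _ oS cS oS _ z2S])
       (use \<kappa>le \<kappa>z2 in \<open>auto intro: holomorphic_on_subset[OF \<kappa>hol] simp: S_def\<close>)
  then have \<kappa>1: "\<kappa> t = 1" if "t \<in> S" for t
    using \<kappa>z2 z2S that unfolding constant_on_def by metis
  \<comment> \<open>Equality in Cauchy-Schwarz: two unit vectors with Hermitian product 1 coincide.
    The norm of \<open>\<phi> t / t\<close> is known on the middle circle only, and the identity
    theorem does the rest.\<close>
  have circ: "\<phi> t = t *s a" if t: "cmod t = r2" for t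
  proof -
    have tS: "t \<in> S" using t r by (simp add: S_def)
    have t0: "t \<noteq> 0" using t r by auto
    have "herm ((1 / t) *s \<phi> t) a = 1"
      using \<kappa>1[OF tS] unfolding \<kappa>_def by (simp add: herm_scale_left)
    moreover have "norm ((1 / t) *s \<phi> t) = 1"
      unfolding norm_vscale using eq[of t] t t0 r by (simp add: norm_divide)
    ultimately have "(norm ((1 / t) *s \<phi> t - a))\<^sup>2 = 0"
      unfolding norm_sq_diff by (simp add: a)
    then have "(1 / t) *s \<phi> t = a" by simp
    then have "t *s a = t *s ((1 / t) *s \<phi> t)" by simp
    also have "\<dots> = \<phi> t" using t0 by (simp add: vector_smult_assoc)
    finally show ?thesis by simp
  qed
  have "\<phi> t = t *s a" if t: "cmod t < 1" for t
  proof -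
    have "\<phi> t $ i - t * a $ i = 0" for i
    proof (rule analytic_continuation[of "\<lambda>t. \<phi> t $ i - t * a $ i" "ball 0 1" "sphere 0 r2" z2])
      show "(\<lambda>t. \<phi> t $ i - t * a $ i) holomorphic_on ball 0 1"
        by (intro holomorphic_intros hol)
      show "z2 islimpt sphere 0 r2"
        using circle_islimpt[of r2 z2 UNIV] z2 r by simp
    qed (use z2 r t circ in auto)
    then show ?thesis by (simp add: vec_eq_iff)
  qed
  then show ?thesis using that by blast
qed

section \<open>The perforated ball\<close>

text \<open>A sequence increasing strictly to 1; the 3 makes \<open>rad 0 = -1/2\<close> and
  \<open>rad 1 = 1/4\<close>, so that \<open>shell 0\<close> is a ball around the origin.\<close>

definition rad :: "nat \<Rightarrow> real"
  where "rad k = 1 - 3 / (2 * real k + 2)"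

text \<open>The unit ball minus spheres that accumulate at its boundary, where each sphere keeps a
  small open cap around a coordinate axis. Since \<open>rad 0 < 0\<close>, the index 0 removes nothing.\<close>

definition perforated_ball :: "(nat \<Rightarrow> 'n) \<Rightarrow> (complex ^ 'n) set"
  where "perforated_ball g = {z. norm z < 1 \<and> (\<forall>k. norm z = rad k \<longrightarrow> (rad k)\<^sup>2 < Re (z $ g k))}"

definition shell :: "nat \<Rightarrow> (complex ^ 'n) set"
  where "shell k = {z. rad k < norm z \<and> norm z < rad (Suc k)}"

lemma rad_less_iff [simp]: "rad k < rad m \<longleftrightarrow> k < m"
  by (simp add: rad_def divide_less_eq less_divide_eq frac_less2)

lemma rad_eq_iff [simp]: "rad k = rad m \<longleftrightarrow> k = m"
  by (metis rad_less_iff linorder_neqE_nat less_irrefl)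

lemma rad_le_iff [simp]: "rad k \<le> rad m \<longleftrightarrow> k \<le> m"
  by (metis rad_less_iff not_less)

lemma rad_less_1 [simp]: "rad k < 1"
  by (simp add: rad_def)

lemma rad_0: "rad 0 < 0"
  by (simp add: rad_def)

lemma rad_pos: "k > 0 \<Longrightarrow> rad k > 0"
  by (simp add: rad_def divide_less_eq)

lemma ex_rad_greater:
  assumes "x < 1" shows "\<exists>k. x < rad k"
proof -
  obtain k :: nat where k: "3 / (1 - x) < real k" using reals_Archimedean2 by blast
  have "0 < 3 / (1 - x)" using assms by simp
  then have "0 < real k" using k by linarith
  have "3 < real k * (1 - x)" using k assms by (simp add: divide_less_eq)
  moreover have "real k * (1 - x) \<le> (2 * real k + 2) * (1 - x)"
    using assms by (intro mult_right_mono) auto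
  ultimately have "3 < (2 * real k + 2) * (1 - x)" by linarith
  then have "3 / (2 * real k + 2) < 1 - x" by (simp add: divide_less_eq mult.commute)
  then show ?thesis by (intro exI[of _ k]) (simp add: rad_def)
qed

lemma ex_rad_interval:
  assumes "0 \<le> x" "x < 1" obtains k where "rad k \<le> x" "x < rad (Suc k)"
proof -
  define m where "m = (LEAST m. x < rad m)"
  have m: "x < rad m" unfolding m_def using ex_rad_greater[OF assms(2)] by (rule LeastI_ex)
  then have "m \<noteq> 0" using assms rad_0 by (metis order_less_le_trans less_asym)
  then obtain k where k: "m = Suc k" by (cases m) auto
  have "\<not> x < rad k" using not_less_Least[of k "\<lambda>m. x < rad m"] k unfolding m_def by simp
  then show ?thesis using that[of k] m k by simp
qed

lemma open_shell: "open (shell k)"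
  unfolding shell_def by (intro open_Collect_conj open_Collect_less continuous_intros)

lemma connected_shell: "connected (shell k :: (complex ^ 'n) set)"
proof -
  have "DIM(complex ^ 'n) = CARD('n) * 2" by simp
  moreover have "CARD('n) \<ge> 1" by (simp add: Suc_leI)
  ultimately have "2 \<le> DIM(complex ^ 'n)" by linarith
  from connected_annulus(1)[OF this, of "rad k" 0 "rad (Suc k)"] show ?thesis
    by (simp add: shell_def)
qed

lemma norm_eq_rad_between:
  assumes "rad k < norm z" "norm z < rad (Suc (Suc k))" "norm z = rad m"
  shows "m = Suc k"
  using assms by simp

lemma shell_subset:
  fixes g :: "nat \<Rightarrow> 'n::finite"
  shows "shell k \<subseteq> perforated_ball g"
proof
  fix z :: "complex ^ 'n" assume "z \<in> shell k"
  then have z: "rad k < norm z" "norm z < rad (Suc k)" by (auto simp: shell_def)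
  have "norm z \<noteq> rad m" for m using z by (auto simp: less_Suc_eq)
  moreover have "norm z < 1" using z rad_less_1[of "Suc k"] by linarith
  ultimately show "z \<in> perforated_ball g" by (simp add: perforated_ball_def)
qed

text \<open>The removed spheres are locally finite inside the unit ball: between two radii that are
  two indices apart only one of the infinitely many conditions is left.\<close>

lemma perforated_ball_local:
  assumes "rad k < norm z" "norm z < rad (Suc (Suc k))"
  shows "z \<in> perforated_ball g \<longleftrightarrow> norm z \<noteq> rad (Suc k) \<or> (rad (Suc k))\<^sup>2 < Re (z $ g (Suc k))"
proof -
  have "norm z < 1" using assms(2) rad_less_1[of "Suc (Suc k)"] by linarith
  moreover have "(\<forall>m. norm z = rad m \<longrightarrow> (rad m)\<^sup>2 < Re (z $ g m)) \<longleftrightarrow>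
      (norm z = rad (Suc k) \<longrightarrow> (rad (Suc k))\<^sup>2 < Re (z $ g (Suc k)))"
    using norm_eq_rad_between[OF assms] by metis
  ultimately show ?thesis
    by (simp add: perforated_ball_def disj_imp)
qed

lemma open_perforated_ball: "open (perforated_ball g)"
proof -
  have "perforated_ball g = (\<Union>k. {z. rad k < norm z \<and> norm z < rad (Suc (Suc k)) \<and>
      (norm z \<noteq> rad (Suc k) \<or> (rad (Suc k))\<^sup>2 < Re (z $ g (Suc k)))})" (is "_ = (\<Union>k. ?U k)")
  proof (intro equalityI subsetI)
    fix z assume z: "z \<in> perforated_ball g"
    then have "norm z < 1" by (simp add: perforated_ball_def)
    then obtain k where k: "rad k \<le> norm z" "norm z < rad (Suc k)"
      using ex_rad_interval[of "norm z"] by auto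
    have "\<exists>m. rad m < norm z \<and> norm z < rad (Suc (Suc m))"
    \<comment> \<open>\<open>rad k \<le> norm z\<close> may be an equality, so the index is lowered
      by one to gain a strict bound; for \<open>k = 0\<close> the bound is strict already.\<close>
    proof (cases k)
      case 0
      then have "rad 0 < norm z" using rad_0 norm_ge_zero[of z] by linarith
      moreover have "norm z < rad (Suc (Suc 0))" using k 0 by (auto intro: less_trans)
      ultimately show ?thesis by blast
    next
      case (Suc m)
      have "rad m < rad (Suc m)" by simp
      then have "rad m < norm z" using k(1) unfolding Suc by linarith
      then show ?thesis using k(2) Suc by blast
    qed
    then obtain m where m: "rad m < norm z" "norm z < rad (Suc (Suc m))" by blast
    with z show "z \<in> (\<Union>k. ?U k)" using perforated_ball_local[OF m, of g] by blast
  next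
    fix z assume "z \<in> (\<Union>k. ?U k)"
    then show "z \<in> perforated_ball g" using perforated_ball_local by blast
  qed
  moreover have "open (?U k)" for k
  proof -
    have "closed {z :: complex ^ 'a. norm z = rad (Suc k)}"
      by (intro closed_Collect_eq continuous_intros)
    then have "open {z :: complex ^ 'a. norm z \<noteq> rad (Suc k)}"
      by (simp add: open_closed Compl_eq)
    then show ?thesis
      by (intro open_Collect_conj open_Collect_disj open_Collect_less continuous_intros)
  qed
  ultimately show ?thesis by auto
qed

lemma adjacent_shells:
  assumes z: "norm z = rad (Suc k)" and e: "e > 0"
  shows "ball z e \<inter> shell k \<noteq> {}" "ball z e \<inter> shell (Suc k) \<noteq> {}"
proof -
  define r where "r = rad (Suc k)"
  have r: "r > 0" unfolding r_def by (rule rad_pos) simp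
  have pt: "(s / r) *\<^sub>R z \<in> ball z e" "norm ((s / r) *\<^sub>R z) = s" if s: "0 < s" "\<bar>s - r\<bar> < e" for s
  proof -
    have "z - (s / r) *\<^sub>R z = (1 - s / r) *\<^sub>R z" by (simp add: scaleR_left_diff_distrib)
    then have "dist z ((s / r) *\<^sub>R z) = \<bar>1 - s / r\<bar> * r" using z by (simp add: dist_norm r_def)
    also have "\<dots> = \<bar>(1 - s / r) * r\<bar>" using r by (simp add: abs_mult)
    also have "(1 - s / r) * r = r - s" using r by (simp add: algebra_simps)
    finally show "(s / r) *\<^sub>R z \<in> ball z e" using s by simp
    show "norm ((s / r) *\<^sub>R z) = s" using s r z by (simp flip: r_def)
  qed
  have "max (max 0 (rad k)) (r - e) < r" using r e by (simp add: r_def)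
  then obtain s where s: "max (max 0 (rad k)) (r - e) < s" "s < r" using dense by blast
  have "(s / r) *\<^sub>R z \<in> ball z e \<inter> shell k"
    using pt[of s] s unfolding shell_def r_def[symmetric] by simp
  then show "ball z e \<inter> shell k \<noteq> {}" by blast
  have "r < min (rad (Suc (Suc k))) (r + e)" using e by (simp add: r_def)
  then obtain s where s: "r < s" "s < min (rad (Suc (Suc k))) (r + e)" using dense by blast
  have "(s / r) *\<^sub>R z \<in> ball z e \<inter> shell (Suc k)"
    using pt[of s] s r unfolding shell_def r_def[symmetric] by simp
  then show "ball z e \<inter> shell (Suc k) \<noteq> {}" by blast
qed

text \<open>Because \<open>r^2 < r\<close> for \<open>0 < r < 1\<close>, this point of the axis lies
  in the open cap. A small ball around it is the passage between two consecutive shells.\<close>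

lemma cap_center: "axis (g (Suc k)) (of_real (rad (Suc k))) \<in> perforated_ball g"
    "norm (axis (g (Suc k)) (of_real (rad (Suc k))) :: complex ^ 'n) = rad (Suc k)"
proof -
  let ?z = "axis (g (Suc k)) (of_real (rad (Suc k))) :: complex ^ 'n"
  have r: "0 < rad (Suc k)" by (rule rad_pos) simp
  show n: "norm ?z = rad (Suc k)" unfolding norm_axis using r by simp
  have "rad (Suc k) * rad (Suc k) < rad (Suc k) * 1"
    using r by (intro mult_strict_left_mono) auto
  then show "?z \<in> perforated_ball g"
    using n by (simp add: perforated_ball_def power2_eq_square)
qed

text \<open>The common induction behind connectedness and uniqueness of continuation:
  \<open>Q\<close> passes through overlapping shells and small balls, all with connected slices. The
  condition on \<open>B\<close> prevents the bounding sphere from cutting through a shell.\<close>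

lemma perforated_ball_propagate:
  fixes g :: "nat \<Rightarrow> 'n::finite" and Q :: "complex ^ 'n \<Rightarrow> bool"
  defines "X \<equiv> \<lambda>B. {z \<in> perforated_ball g. norm z < B}"
  assumes spread: "\<And>T W. open T \<Longrightarrow> connected T \<Longrightarrow> (\<And>p v. connected {t. p + t *s v \<in> T}) \<Longrightarrow> T \<subseteq> X B \<Longrightarrow>
      open W \<Longrightarrow> W \<noteq> {} \<Longrightarrow> W \<subseteq> T \<Longrightarrow> (\<And>z. z \<in> W \<Longrightarrow> Q z) \<Longrightarrow> (\<And>z. z \<in> T \<Longrightarrow> Q z)"
    and B: "\<And>j. rad j < B \<Longrightarrow> rad (Suc j) \<le> B" "B \<le> 1"
    and k: "rad (Suc k) \<le> B" "\<And>z. z \<in> shell k \<Longrightarrow> Q z" and z: "z \<in> X B"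
  shows "Q z"
proof -
  have shX: "shell j \<subseteq> X B" if "rad (Suc j) \<le> B" for j
    using shell_subset[of j g] that by (auto simp: X_def shell_def)
  have sh_slice: "connected {t. p + t *s v \<in> shell j}" for p v :: "complex ^ 'n" and j
    unfolding shell_def by (rule connected_slice_shell)
  have oX: "open (X B)"
  proof -
    have "X B = perforated_ball g \<inter> ball 0 B" by (auto simp: X_def)
    then show ?thesis using open_perforated_ball by auto
  qed
  have via: "\<And>z. z \<in> T \<Longrightarrow> Q z" if T: "T = shell j \<or> T = ball p e" "T \<subseteq> X B"
    and W: "open W" "W \<inter> T \<noteq> {}" "\<And>z. z \<in> W \<Longrightarrow> Q z" for T W j p e
  proof (rule spread[of T "W \<inter> T"])
    show "open T" "connected T" using T(1) open_shell connected_shell by auto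
    then show "open (W \<inter> T)" using W by auto
    show "connected {t. p + t *s v \<in> T}" for p v
      using T(1) sh_slice connected_slice_convex[OF convex_ball] by metis
  qed (use T W in auto)
  \<comment> \<open>An equivalence, because the starting shell \<open>k\<close> may be the outermost
    one and \<open>Q\<close> must then travel inwards.\<close>
  have cross: "(\<forall>z\<in>shell j. Q z) \<longleftrightarrow> (\<forall>z\<in>shell (Suc j). Q z)" if j: "rad (Suc (Suc j)) \<le> B" for j
  proof -
    define h :: "complex ^ 'n" where "h = axis (g (Suc j)) (of_real (rad (Suc j)))"
    have h: "h \<in> perforated_ball g" "norm h = rad (Suc j)" unfolding h_def by (rule cap_center)+
    have "rad (Suc j) < rad (Suc (Suc j))" by simp
    then have "norm h < B" using h(2) j by linarith
    then have "h \<in> X B" using h(1) unfolding X_def by simp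
    then obtain e where e: "e > 0" "ball h e \<subseteq> X B" using oX openE by blast
    note ne = adjacent_shells[OF h(2) e(1)]
    have j': "rad (Suc j) \<le> B" using j \<open>rad (Suc j) < rad (Suc (Suc j))\<close> by linarith
    show ?thesis
    proof
      assume Q: "\<forall>z\<in>shell j. Q z"
      have b: "Q z" if "z \<in> ball h e" for z
        by (rule via[of "ball h e" _ h e "shell j" z]) (use that Q e ne(1) open_shell in auto)
      show "\<forall>z\<in>shell (Suc j). Q z"
        using via[of "shell (Suc j)" "Suc j" _ _ "ball h e"] shX[OF j] ne(2) b by auto
    next
      assume Q: "\<forall>z\<in>shell (Suc j). Q z"
      have b: "Q z" if "z \<in> ball h e" for z
        by (rule via[of "ball h e" _ h e "shell (Suc j)" z]) (use that Q e ne(2) open_shell in auto)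
      show "\<forall>z\<in>shell j. Q z"
        using via[of "shell j" j _ _ "ball h e"] shX[OF j'] ne(1) b by auto
    qed
  qed
  have Qsh: "\<forall>z\<in>shell j. Q z" if "rad (Suc j) \<le> B" for j
  proof -
    have "(\<forall>z\<in>shell 0. Q z) \<longleftrightarrow> (\<forall>z\<in>shell j. Q z)" if "rad (Suc j) \<le> B" for j
      using that
    proof (induction j)
      case (Suc j)
      have "rad (Suc j) < rad (Suc (Suc j))" by simp
      then have "rad (Suc j) \<le> B" using Suc.prems by linarith
      then show ?case using Suc cross by blast
    qed simp
    then show ?thesis using k that by blast
  qed
  have zX: "z \<in> perforated_ball g" "norm z < B" using z by (auto simp: X_def)
  then have "norm z < 1" using B(2) by linarith
  then obtain j where j: "rad j \<le> norm z" "norm z < rad (Suc j)"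
    using ex_rad_interval[of "norm z"] by auto
  have jB: "rad (Suc j) \<le> B" using B(1) j(1) zX(2) by auto
  show ?thesis
  proof (cases "rad j = norm z")
    case False
    then show ?thesis using Qsh[OF jB] j by (simp add: shell_def)
  next
    case True
    then obtain m where m: "j = Suc m" using rad_0 norm_ge_zero[of z] by (cases j) auto
    \<comment> \<open>Here \<open>z\<close> lies in a cap of a removed sphere, and a small ball
      around it reaches the shell outside.\<close>
    obtain e where e: "e > 0" "ball z e \<subseteq> X B" using oX openE z by blast
    have "shell j \<inter> ball z e \<noteq> {}" using adjacent_shells(2)[of z m e] True m e by auto
    then show ?thesis
      using via[of "ball z e" j z e "shell j" z] e Qsh[OF jB] open_shell by auto
  qed
qed

lemma connected_perforated_ball: "connected (perforated_ball g)"
proof -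
  let ?D = "perforated_ball g"
  let ?C = "connected_component_set ?D 0"
  have 0: "(0 :: complex ^ 'a) \<in> shell 0" using rad_0 rad_pos[of 1] by (simp add: shell_def)
  have "z \<in> ?C" if z: "z \<in> ?D" for z
  proof (rule perforated_ball_propagate[where B = 1 and k = 0 and g = g and z = z and Q = "\<lambda>z. z \<in> ?C"])
    show "z \<in> {z \<in> ?D. norm z < 1}" using z by (simp add: perforated_ball_def)
    show "z \<in> ?C" if "z \<in> shell 0" for z
      using connected_component_maximal[OF 0 connected_shell shell_subset[of 0 g]] that by blast
    fix T W z assume T: "connected T" "T \<subseteq> {z \<in> ?D. norm z < 1}" "W \<noteq> {}" "W \<subseteq> T"
      "\<And>z. z \<in> W \<Longrightarrow> z \<in> ?C" "z \<in> T"
    then obtain w where w: "w \<in> T" "w \<in> ?C" by blast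
    have "T \<subseteq> connected_component_set ?D w"
      using T by (intro connected_component_maximal[OF w(1)]) auto
    then show "z \<in> ?C" using connected_component_eq[OF w(2)] T by blast
  qed (auto intro: less_imp_le)
  then have "?D = ?C" using connected_component_subset[of ?D 0] by blast
  then show ?thesis using connected_connected_component[of ?D 0] by simp
qed

text \<open>Each shell extends \<open>f\<close> to the ball it surrounds. Propagation inwards
  through the caps shows that this extension agrees with \<open>f\<close> on the part of
  \<open>D\<close> in that ball, so any two extensions agree on \<open>shell 0\<close>, hence on the
  smaller ball, and they glue.\<close>

lemma perforated_ball_extension:
  fixes f :: "complex ^ 'n \<Rightarrow> complex" and g :: "nat \<Rightarrow> 'n"
  assumes card: "CARD('n) \<ge> 2" and f: "lhol f (perforated_ball g)" "continuous_on (perforated_ball g) f"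
  obtains F where "lhol F (ball 0 1)" "\<And>z. z \<in> perforated_ball g \<Longrightarrow> F z = f z"
proof -
  have "\<exists>F. lhol F (ball 0 (rad (Suc k))) \<and> (\<forall>z\<in>shell k. F z = f z)" for k
  proof -
    note * = lhol_subset[OF f(1) shell_subset[of k]] continuous_on_subset[OF f(2) shell_subset[of k]]
    obtain F where "lhol F (ball 0 (rad (Suc k)))" "\<And>z. z \<in> shell k \<Longrightarrow> F z = f z"
      using hartogs_shell[OF card *[unfolded shell_def]] unfolding shell_def by metis
    then show ?thesis by blast
  qed
  then obtain G where G: "\<And>k. lhol (G k) (ball 0 (rad (Suc k)))" "\<And>k z. z \<in> shell k \<Longrightarrow> G k z = f z"
    by metis
  have Gf: "G k z = f z" if z: "z \<in> perforated_ball g" "norm z < rad (Suc k)" for k z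
  proof (rule perforated_ball_propagate[where B = "rad (Suc k)" and k = k and g = g and z = z and Q = "\<lambda>z. G k z = f z"])
    fix T W z assume T: "open T" "\<And>p v. connected {t. p + t *s v \<in> T}"
      "T \<subseteq> {z \<in> perforated_ball g. norm z < rad (Suc k)}" "open W" "W \<noteq> {}" "W \<subseteq> T"
      "\<And>z. z \<in> W \<Longrightarrow> G k z = f z" "z \<in> T"
    obtain w where w: "w \<in> W" using T by blast
    have Gk: "lhol (G k) T"
      by (rule lhol_subset[OF G(1)]) (use T(3) in auto)
    have "lhol f T"
      by (rule lhol_subset[OF f(1)]) (use T(3) in auto)
    with Gk show "G k z = f z"
      by (rule lhol_identity[of "G k" T f W w]) (use T w in auto)
  qed (use z G in \<open>auto intro: less_imp_le\<close>)
  have GG: "G k z = G m z" if "k \<le> m" "norm z < rad (Suc k)" for k m z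
  proof (rule lhol_identity[of "G k" "ball 0 (rad (Suc k))" "G m" "shell 0" 0])
    have "rad (Suc 0) \<le> rad (Suc k)" by simp
    then show sub: "shell 0 \<subseteq> ball (0 :: complex ^ 'n) (rad (Suc k))"
      using order_less_le_trans[OF _ \<open>rad (Suc 0) \<le> rad (Suc k)\<close>] by (auto simp: shell_def)
    have "rad (Suc k) \<le> rad (Suc m)" using that by simp
    then show "lhol (G m) (ball 0 (rad (Suc k)))"
      by (rule lhol_subset[OF G(1) subset_ball])
    show "(0 :: complex ^ 'n) \<in> shell 0" using rad_0 rad_pos[of 1] by (simp add: shell_def)
    show "G k z = G m z" if "z \<in> shell 0" for z :: "complex ^ 'n"
    proof -
      have "z \<in> perforated_ball g" "norm z < rad (Suc k)" "norm z < rad (Suc m)"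
        using that shell_subset[of 0 g] sub order_less_le_trans[OF _ \<open>rad (Suc k) \<le> rad (Suc m)\<close>]
        by auto
      then show ?thesis by (simp add: Gf)
    qed
    show "connected {t. p + t *s v \<in> ball 0 (rad (Suc k))}" for p v :: "complex ^ 'n"
      by (rule connected_slice_convex[OF convex_ball])
  qed (use that G open_shell in auto)
  define F where "F z = G (LEAST k. norm z < rad (Suc k)) z" for z
  have FG: "F z = G m z" if "norm z < rad (Suc m)" for z m
    unfolding F_def
    by (intro GG Least_le) (use that LeastI[of "\<lambda>k. norm z < rad (Suc k)", OF that] in auto)
  have ex: "\<exists>k. norm z < rad (Suc k)" if "norm z < 1" for z :: "complex ^ 'n"
    using ex_rad_interval[OF norm_ge_zero that] by blast
  have "lhol F (ball 0 1)"
  proof (rule lhol_locally)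
    fix z :: "complex ^ 'n" assume "z \<in> ball 0 1"
    then obtain k where k: "norm z < rad (Suc k)" using ex[of z] by auto
    have "lhol F (ball 0 (rad (Suc k)))" by (rule lhol_cong[OF G(1)]) (simp add: FG)
    then show "\<exists>T. open T \<and> z \<in> T \<and> lhol F T" using k by (intro exI[of _ "ball 0 (rad (Suc k))"]) simp
  qed
  moreover have "F z = f z" if z: "z \<in> perforated_ball g" for z
  proof -
    obtain k where "norm z < rad (Suc k)" using ex[of z] z by (auto simp: perforated_ball_def)
    then show ?thesis using FG Gf z by simp
  qed
  ultimately show ?thesis using that by blast
qed

section \<open>Rigidity\<close>

lemma unit_direction:
  fixes z :: "complex ^ 'n"
  obtains v where "norm v = 1" "z = of_real (norm z) *s v"
proof (cases "z = 0")
  case True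
  then show ?thesis using that[of "axis undefined 1"] by (simp add: norm_axis)
next
  case False
  then have "complex_of_real (norm z) * complex_of_real (1 / norm z) = 1" by simp
  then have "z = of_real (norm z) *s (complex_of_real (1 / norm z) *s z)"
    unfolding vector_smult_assoc by simp
  moreover have "norm (complex_of_real (1 / norm z) *s z) = 1"
    unfolding norm_vscale norm_of_real using False by simp
  ultimately show ?thesis using that by blast
qed

text \<open>On the line through 0 and \<open>z\<close>, a circle in a full shell encloses
  \<open>z\<close>; on it \<open>norm (F _)\<close> has a maximum \<open>B < 1\<close>. The maximum
  principle for the scalar function \<open>herm (F (s *s v)) (F z)\<close> yields
  \<open>(norm (F z))^2 \<le> B * norm (F z)\<close>.\<close>

lemma lhol_self_map_of_ball:
  fixes F :: "complex ^ 'n \<Rightarrow> complex ^ 'n" and g :: "nat \<Rightarrow> 'n"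
  assumes hol: "\<And>i. lhol (\<lambda>z. F z $ i) (ball 0 1)"
    and D: "\<And>z. z \<in> perforated_ball g \<Longrightarrow> norm (F z) < 1" and z: "norm z < 1"
  shows "norm (F z) < 1"
proof (cases "F z = 0")
  case False
  obtain k where k: "norm z < rad (Suc k)" "0 < rad (Suc k)"
    using ex_rad_interval[OF norm_ge_zero z] rad_pos by (metis zero_less_Suc)
  have "max (norm z) (rad (Suc k)) < rad (Suc (Suc k))" using k by (auto intro: less_trans)
  then obtain r where r: "max (norm z) (rad (Suc k)) < r" "r < rad (Suc (Suc k))" using dense by blast
  then have r01: "0 < r" "r < 1" using k rad_less_1[of "Suc (Suc k)"] by linarith+
  obtain v t where v: "norm v = 1" and zt: "z = t *s v"
    using unit_direction by metis
  have t: "cmod t < r" using r(1) v by (simp add: zt norm_vscale)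
  have hol1: "(\<lambda>s. F (0 + s *s v) $ i) holomorphic_on ball 0 1" for i
    by (rule lholD[OF hol]) (simp add: norm_vscale v)
  then have hol2: "(\<lambda>s. F (s *s v) $ i) holomorphic_on ball 0 1" for i by simp
  have hhol: "(\<lambda>s. herm (F (s *s v)) (F z)) holomorphic_on ball 0 1"
    unfolding herm_def by (intro holomorphic_intros hol2)
  have "continuous_on (ball 0 1) (\<lambda>s. \<chi> i. F (s *s v) $ i)"
    by (intro continuous_on_vec_lambda holomorphic_on_imp_continuous_on hol2)
  then have contF: "continuous_on (sphere 0 r) (\<lambda>s. norm (F (s *s v)))"
    using r01 by (intro continuous_on_norm) (auto intro: continuous_on_subset)
  have "complex_of_real r \<in> sphere 0 r" using r01 by simp
  then obtain s0 where s0: "s0 \<in> sphere 0 r" "\<And>s. s \<in> sphere 0 r \<Longrightarrow> norm (F (s *s v)) \<le> norm (F (s0 *s v))"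
    using continuous_attains_sup[OF compact_sphere _ contF] by blast
  define B where "B = norm (F (s0 *s v))"
  have "s0 *s v \<in> shell (Suc k)" using s0(1) r v by (simp add: shell_def norm_vscale)
  then have B1: "B < 1" unfolding B_def using shell_subset by (intro D) auto
  have "cmod (herm (F (t *s v)) (F z)) \<le> B * norm (F z)"
  proof (rule maximum_modulus_frontier[of "\<lambda>s. herm (F (s *s v)) (F z)" "cball 0 r"])
    show "(\<lambda>s. herm (F (s *s v)) (F z)) holomorphic_on interior (cball 0 r)"
      using r01 by (intro holomorphic_on_subset[OF hhol]) auto
    show "continuous_on (closure (cball 0 r)) (\<lambda>s. herm (F (s *s v)) (F z))"
      using r01 by (intro continuous_on_subset[OF holomorphic_on_imp_continuous_on[OF hhol]]) auto
    fix s :: complex assume "s \<in> frontier (cball 0 r)"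
    then have "norm (F (s *s v)) \<le> B" using r01 s0(2) unfolding B_def by simp
    then show "cmod (herm (F (s *s v)) (F z)) \<le> B * norm (F z)"
      by (intro order_trans[OF norm_herm_le] mult_right_mono) auto
  qed (use t in auto)
  then have "norm (F z) * norm (F z) \<le> B * norm (F z)"
    unfolding zt[symmetric] herm_self norm_of_real by (simp add: power2_eq_square)
  then show ?thesis using False B1 by simp
qed simp

text \<open>On either side of the sphere \<open>norm (F _)\<close> avoids \<open>r\<close> on a
  connected region, so one witness decides the side for all its points; continuity settles the
  sphere itself.\<close>

lemma sphere_preserved_near_fixed_point:
  fixes F :: "complex ^ 'n \<Rightarrow> complex ^ 'm"
  assumes cont: "continuous_on (ball p e) F" and e: "e > 0" and p: "norm p = r" "r > 0"
    and ne: "\<And>z. z \<in> ball p e \<Longrightarrow> norm z \<noteq> r \<Longrightarrow> norm (F z) \<noteq> r"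
    and lo: "\<And>\<epsilon>. \<epsilon> > 0 \<Longrightarrow> \<exists>w\<in>ball p \<epsilon>. norm w < r \<and> norm (F w) < r"
    and hi: "\<And>\<epsilon>. \<epsilon> > 0 \<Longrightarrow> \<exists>w\<in>ball p \<epsilon>. norm w > r \<and> norm (F w) > r"
  obtains d where "d > 0" "\<And>z. z \<in> ball p d \<Longrightarrow> norm z = r \<Longrightarrow> norm (F z) = r"
proof -
  \<comment> \<open>Moving a point of \<open>ball p d\<close> radially to a norm within
    \<open>d\<close> of \<open>r\<close> displaces it by less than \<open>2 * d\<close>, so it stays
    within \<open>3 * d \<le> e\<close> of \<open>p\<close>; the bound \<open>r / 2\<close> keeps it
    away from 0.\<close>
  define d where "d = min (e / 3) (r / 2)"
  have d: "d > 0" "3 * d \<le> e" "2 * d \<le> r" using e p by (auto simp: d_def)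
  \<comment> \<open>Polar coordinates: \<open>h\<close> maps an interval of norms times the ball
    onto a connected set that contains all points of the ball with norm in that interval, on the
    inner and the outer side alike.\<close>
  define h where "h = (\<lambda>(s, z :: complex ^ 'n). (s / norm z) *\<^sub>R z)"
  have zr: "\<bar>norm z - r\<bar> < d" "norm z > 0" if "z \<in> ball p d" for z
  proof -
    have "\<bar>norm z - norm p\<bar> \<le> norm (z - p)" by (rule norm_triangle_ineq3)
    also have "\<dots> < d" using that by (simp add: dist_norm norm_minus_commute)
    finally show "\<bar>norm z - r\<bar> < d" using p by simp
    then show "norm z > 0" using d by linarith
  qed
  have h_norm: "norm (h (s, z)) = \<bar>s\<bar>" and h_ball: "\<bar>s - r\<bar> < d \<Longrightarrow> h (s, z) \<in> ball p e"
    if z: "z \<in> ball p d" for s z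
  proof -
    show "norm (h (s, z)) = \<bar>s\<bar>" using zr[OF z] by (simp add: h_def)
    assume s: "\<bar>s - r\<bar> < d"
    have "h (s, z) - z = ((s - norm z) / norm z) *\<^sub>R z"
      using zr(2)[OF z] by (simp add: h_def diff_divide_distrib scaleR_left_diff_distrib)
    then have "norm (h (s, z) - z) = \<bar>s - norm z\<bar>" using zr(2)[OF z] by simp
    also have "\<dots> < 2 * d" using s zr(1)[OF z] by linarith
    finally have "dist (h (s, z)) z < 2 * d" by (simp add: dist_norm)
    moreover have "dist z p < d" using z by (simp add: dist_commute)
    ultimately have "dist (h (s, z)) p < 3 * d" using dist_triangle[of "h (s, z)" p z] by linarith
    then show "h (s, z) \<in> ball p e" using d by (simp add: dist_commute)
  qed
  have h_self: "h (norm z, z) = z" if "z \<in> ball p d" for z using zr(2)[OF that] by (simp add: h_def)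
  have conn: "connected ((\<lambda>z. norm (F z)) ` h ` (I \<times> ball p d))"
    if I: "is_interval I" "\<And>s. s \<in> I \<Longrightarrow> \<bar>s - r\<bar> < d" for I
  proof (rule connected_continuous_image)
    show "continuous_on (h ` (I \<times> ball p d)) (\<lambda>z. norm (F z))"
      using h_ball I(2) by (intro continuous_on_norm continuous_on_subset[OF cont]) auto
    show "connected (h ` (I \<times> ball p d))"
    proof (rule connected_continuous_image)
      show "connected (I \<times> ball p d)"
        using I(1) by (intro connected_Times) (auto simp: is_interval_connected_1)
      show "continuous_on (I \<times> ball p d) h"
        unfolding h_def case_prod_unfold using zr(2) by (intro continuous_intros) force
    qed
  qed
  have below: "norm (F z) < r" if z: "z \<in> ball p d" "norm z < r" for z
  proof (rule ccontr)
    assume "\<not> norm (F z) < r"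
    let ?I = "{r - d<..<r}"
    obtain w where w: "w \<in> ball p d" "norm w < r" "norm (F w) < r" using lo[OF d(1)] by blast
    have mem: "norm (F x) \<in> (\<lambda>z. norm (F z)) ` h ` (?I \<times> ball p d)" if "x \<in> ball p d" "norm x < r" for x
      using that zr(1)[OF that(1)] h_self[OF that(1)]
      by (intro image_eqI[OF refl] image_eqI[of _ _ "(norm x, x)"]) auto
    have "connected ((\<lambda>z. norm (F z)) ` h ` (?I \<times> ball p d))" using d by (intro conn) (auto simp: is_interval_oo)
    from connectedD_interval[OF this mem[OF w(1,2)] mem[OF z], of r]
    have "r \<in> (\<lambda>z. norm (F z)) ` h ` (?I \<times> ball p d)" using w \<open>\<not> norm (F z) < r\<close> by simp
    then obtain s x where sx: "s \<in> ?I" "x \<in> ball p d" "norm (F (h (s, x))) = r" by auto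
    then show False using ne[OF h_ball[of x s]] h_norm[of x s] d by auto
  qed
  have above: "norm (F z) > r" if z: "z \<in> ball p d" "norm z > r" for z
  proof (rule ccontr)
    assume "\<not> norm (F z) > r"
    let ?I = "{r<..<r + d}"
    obtain w where w: "w \<in> ball p d" "norm w > r" "norm (F w) > r" using hi[OF d(1)] by blast
    have mem: "norm (F x) \<in> (\<lambda>z. norm (F z)) ` h ` (?I \<times> ball p d)" if "x \<in> ball p d" "norm x > r" for x
      using that zr(1)[OF that(1)] h_self[OF that(1)]
      by (intro image_eqI[OF refl] image_eqI[of _ _ "(norm x, x)"]) auto
    have "connected ((\<lambda>z. norm (F z)) ` h ` (?I \<times> ball p d))" using d by (intro conn) (auto simp: is_interval_oo)
    from connectedD_interval[OF this mem[OF z] mem[OF w(1,2)], of r]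
    have "r \<in> (\<lambda>z. norm (F z)) ` h ` (?I \<times> ball p d)" using w \<open>\<not> norm (F z) > r\<close> by simp
    then obtain s x where sx: "s \<in> ?I" "x \<in> ball p d" "norm (F (h (s, x))) = r" by auto
    then show False using ne[OF h_ball[of x s]] h_norm[of x s] d by auto
  qed
  have "norm (F z) = r" if z: "z \<in> ball p d" "norm z = r" for z
  proof -
    have "ball p d \<subseteq> ball p e" using d by (intro subset_ball) linarith
    then have "isCont F z"
      using z cont by (simp add: continuous_on_eq_continuous_at subset_iff)
    then have lim: "((\<lambda>s. norm (F (s *\<^sub>R z))) \<longlongrightarrow> norm (F z)) (at 1)"
      by (intro tendsto_norm isCont_tendsto_compose[of z F]) (auto intro!: tendsto_eq_intros)
    have "((\<lambda>s. s *\<^sub>R z) \<longlongrightarrow> z) (at 1)" by (auto intro!: tendsto_eq_intros)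
    then have ev: "eventually (\<lambda>s. s *\<^sub>R z \<in> ball p d) (at (1::real))"
      by (rule topological_tendstoD) (use z in auto)
    have "norm (F z) \<le> r"
    proof (rule tendsto_upperbound)
      show "((\<lambda>s. norm (F (s *\<^sub>R z))) \<longlongrightarrow> norm (F z)) (at_left 1)"
        using lim by (rule tendsto_within_subset) simp
      have "eventually (\<lambda>s. s *\<^sub>R z \<in> ball p d) (at_left (1::real))"
        using ev by (simp add: eventually_at_split)
      moreover have "eventually (\<lambda>s. 0 < s \<and> s < 1) (at_left (1::real))"
        using eventually_at_left_real[of 0 1] by simp
      ultimately show "eventually (\<lambda>s. norm (F (s *\<^sub>R z)) \<le> r) (at_left 1)"
        by eventually_elim (intro less_imp_le below, use z p in auto)
    qed simp
    moreover have "r \<le> norm (F z)"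
    proof (rule tendsto_lowerbound)
      show "((\<lambda>s. norm (F (s *\<^sub>R z))) \<longlongrightarrow> norm (F z)) (at_right 1)"
        using lim by (rule tendsto_within_subset) simp
      have "eventually (\<lambda>s. s *\<^sub>R z \<in> ball p d) (at_right (1::real))"
        using ev by (simp add: eventually_at_split)
      moreover have "eventually (\<lambda>s. 1 < s \<and> s < 2) (at_right (1::real))"
        using eventually_at_right_real[of 1 2] by simp
      ultimately show "eventually (\<lambda>s. r \<le> norm (F (s *\<^sub>R z))) (at_right 1)"
        by eventually_elim (intro less_imp_le above, use z p in auto)
    qed simp
    ultimately show ?thesis by simp
  qed
  then show ?thesis using that d(1) by blast
qed

text \<open>The points \<open>c + \<sigma> *s u\<close> and \<open>c - \<sigma> *s u\<close> of the
  sphere have midpoint \<open>c\<close>, so one of them has real part at most \<open>norm c\<close>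
  in the coordinate \<open>g k\<close>. This is below the cap height \<open>(rad k)^2\<close> once
  \<open>rad k\<close> exceeds \<open>sqrt (norm c)\<close>.\<close>

lemma line_crosses_sphere_off_cap:
  assumes u: "norm u = 1" "herm c u = 0" and c: "norm c < 1"
  obtains k0 where "\<And>k. k0 \<le> k \<Longrightarrow> rad k > 0"
    "\<And>k. k0 \<le> k \<Longrightarrow> \<exists>x. x \<noteq> 0 \<and> norm (c + x *s u) = rad k \<and> Re ((c + x *s u) $ g k) < (rad k)\<^sup>2"
proof -
  have "sqrt (norm c) < 1" using c by simp
  then obtain k0 where k0: "sqrt (norm c) < rad k0" using ex_rad_greater by blast
  have r: "sqrt (norm c) < rad k" if "k0 \<le> k" for k using k0 that rad_le_iff[of k0 k] by linarith
  have pos: "rad k > 0" if "k0 \<le> k" for k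
    using r[OF that] by (rule order_le_less_trans[rotated]) simp
  have "\<exists>x. x \<noteq> 0 \<and> norm (c + x *s u) = rad k \<and> Re ((c + x *s u) $ g k) < (rad k)\<^sup>2" if k: "k0 \<le> k" for k
  proof -
    have "(sqrt (norm c))\<^sup>2 < (rad k)\<^sup>2" using r[OF k] pos[OF k] by (subst less_sq) auto
    then have c2: "norm c < (rad k)\<^sup>2" by simp
    have "rad k * rad k < rad k * 1" using pos[OF k] by (intro mult_strict_left_mono) auto
    then have "norm c < rad k" using c2 by (simp add: power2_eq_square)
    then have lt: "(norm c)\<^sup>2 < (rad k)\<^sup>2" using pos[OF k] by (subst less_sq) auto
    define \<sigma> where "\<sigma> = complex_of_real (sqrt ((rad k)\<^sup>2 - (norm c)\<^sup>2))"
    have \<sigma>: "(cmod \<sigma>)\<^sup>2 = (rad k)\<^sup>2 - (norm c)\<^sup>2"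
      using lt unfolding \<sigma>_def norm_of_real by simp
    then have \<sigma>0: "\<sigma> \<noteq> 0" using lt by auto
    have n: "norm (c + x *s u) = rad k" if "cmod x = cmod \<sigma>" for x
    proof -
      have "(norm (c + x *s u))\<^sup>2 = (rad k)\<^sup>2"
        unfolding norm_sq_orthogonal_line[OF u(2,1)] that \<sigma> by simp
      then show ?thesis by (rule power2_eq_imp_eq) (simp_all add: pos[OF k] less_imp_le)
    qed
    have "Re ((c + \<sigma> *s u) $ g k) + Re ((c + (- \<sigma>) *s u) $ g k) = 2 * Re (c $ g k)" by simp
    also have "\<dots> \<le> 2 * norm c"
      using complex_Re_le_cmod[of "c $ g k"] Finite_Cartesian_Product.norm_nth_le[of c "g k"] by linarith
    finally have "Re ((c + \<sigma> *s u) $ g k) < (rad k)\<^sup>2 \<or> Re ((c + (- \<sigma>) *s u) $ g k) < (rad k)\<^sup>2"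
      using c2 by linarith
    then show ?thesis
    proof
      assume "Re ((c + \<sigma> *s u) $ g k) < (rad k)\<^sup>2"
      then show ?thesis using \<sigma>0 n[of \<sigma>] by blast
    next
      assume "Re ((c + (- \<sigma>) *s u) $ g k) < (rad k)\<^sup>2"
      then show ?thesis using \<sigma>0 n[of "- \<sigma>"] by (intro exI[of _ "- \<sigma>"]) auto
    qed
  qed
  then show ?thesis using that pos by blast
qed

text \<open>The complex line through \<open>p\<close> and \<open>q\<close> meets the sphere in a
  circle containing both, and reflection carries the property along it from an arc near
  \<open>p\<close> to \<open>q\<close>.\<close>

lemma sphere_preserved:
  fixes F :: "complex ^ 'n \<Rightarrow> complex ^ 'n"
  assumes hol: "\<And>i. lhol (\<lambda>z. F z $ i) (ball 0 1)" and r: "0 < r" "r < 1"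
    and p: "norm p = r" and d: "d > 0" "\<And>z. z \<in> ball p d \<Longrightarrow> norm z = r \<Longrightarrow> norm (F z) = r"
    and q: "norm q = r"
  shows "norm (F q) = r"
proof (cases "q = p")
  case True
  then show ?thesis using d q by simp
next
  case False
  then obtain c u s t where u: "norm u = 1" "herm c u = 0" "p = c + s *s u" "q = c + t *s u" "s \<noteq> t"
    using line_normal_form[of p q] by metis
  note nl = norm_sq_orthogonal_line[OF u(2,1)]
  have sq: "(cmod s)\<^sup>2 = r\<^sup>2 - (norm c)\<^sup>2" "(cmod t)\<^sup>2 = r\<^sup>2 - (norm c)\<^sup>2"
    using nl[of s] nl[of t] p q u by simp_all
  then have st: "cmod s = cmod t" by (intro power2_eq_imp_eq[OF trans[OF sq(1) sq(2)[symmetric]]]) simp_all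
  then have s0: "cmod s > 0" using u(5) by auto
  define b where "b = sqrt (1 - (norm c)\<^sup>2)"
  have "r\<^sup>2 < 1\<^sup>2" using r by (subst less_sq) auto
  then have "(cmod s)\<^sup>2 < 1 - (norm c)\<^sup>2" using sq by simp
  then have sb: "cmod s < b" unfolding b_def by (rule real_less_rsqrt)
  have "norm ((\<lambda>x. F (c + x *s u)) t) = r"
  proof (rule norm_const_on_circle[where \<phi> = "\<lambda>x. F (c + x *s u)" and b = b and s = "cmod s"
        and A = "{x. c + x *s u \<in> ball p d}" and w = s and r = r and t = t])
    show "(\<lambda>x. F (c + x *s u) $ i) holomorphic_on ball 0 b" for i
    proof (rule lholD[OF hol])
      fix x :: complex assume "x \<in> ball 0 b"
      then have "(cmod x)\<^sup>2 < b\<^sup>2" by (intro power_strict_mono) auto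
      moreover have "0 < 1 - (norm c)\<^sup>2" using \<open>(cmod s)\<^sup>2 < 1 - (norm c)\<^sup>2\<close> by (rule order_le_less_trans[rotated]) simp
      ultimately have "(norm (c + x *s u))\<^sup>2 < 1\<^sup>2" unfolding nl b_def by simp
      then show "c + x *s u \<in> ball 0 1" by (subst (asm) less_sq) auto
    qed
    show "open {x. c + x *s u \<in> ball p d}" by (rule open_line_slice) simp
    show "s \<in> {x. c + x *s u \<in> ball p d}" using d(1) u(3) by simp
    fix x assume x: "x \<in> {x. c + x *s u \<in> ball p d}" "cmod x = cmod s"
    have "(norm (c + x *s u))\<^sup>2 = r\<^sup>2" unfolding nl x(2) sq(1) by simp
    then have "norm (c + x *s u) = r" by (rule power2_eq_imp_eq) (simp_all add: r less_imp_le)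
    then show "norm (F (c + x *s u)) = r" using d(2) x(1) by simp
  qed (use s0 sb st in auto)
  then show ?thesis by (simp add: u(4))
qed

text \<open>Two conjugate multiples of the axis vector \<open>e\<close>, just inside the rim of the
  cap, have images in the cap. Averaging them gives \<open>r^2 < C * Re (v $ i)\<close> for the
  image \<open>v\<close> of \<open>e\<close>; with \<open>C\<close> close to \<open>r^2\<close> this
  excludes \<open>Re (v $ i) < 1\<close>, and a unit vector with \<open>Re (v $ i) \<ge> 1\<close>
  is \<open>e\<close>.\<close>

lemma unitary_preserving_cap_fixes_axis:
  fixes A :: "complex ^ 'n ^ 'n" and k :: nat
  assumes iso: "\<And>z. norm z < 1 \<Longrightarrow> norm (A *v z) = norm z" and k: "k > 0"
    and D: "\<And>z. z \<in> perforated_ball g \<Longrightarrow> A *v z \<in> perforated_ball g"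
  shows "A *v axis (g k) 1 = axis (g k) 1"
proof -
  define r where "r = rad k"
  have r: "0 < r" "r < 1" unfolding r_def using rad_pos[OF k] by auto
  define i where "i = g k"
  define e :: "complex ^ 'n" where "e = axis i 1"
  define v where "v = A *v e"
  have Ascale: "A *v (t *s e) = t *s v" for t
    by (simp add: v_def matrix_vector_mult_def vec_eq_iff sum_distrib_left mult_ac)
  have e: "norm e = 1" "e $ i = 1" unfolding e_def by (simp_all add: norm_axis)
  have nv: "norm v = 1"
  proof -
    have "norm (A *v (of_real r *s e)) = norm (complex_of_real r *s e)"
      by (rule iso) (use r e in \<open>simp add: norm_vscale\<close>)
    then show ?thesis using r e by (simp add: Ascale norm_vscale)
  qed
  have "Re (v $ i) \<ge> 1"
  proof (rule ccontr)
    assume "\<not> Re (v $ i) \<ge> 1"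
    then have \<alpha>: "Re (v $ i) < 1" by simp
    have r2: "r\<^sup>2 < r" using r mult_strict_left_mono[of r 1 r] by (simp add: power2_eq_square)
    \<comment> \<open>\<open>C\<close> is the real part of the test points
      \<open>Complex C s\<close> and \<open>Complex C (- s)\<close> of modulus \<open>r\<close>:
      above the cap height, yet so close to it that the factor \<open>Re (v $ i)\<close> pushes it
      down again.\<close>
    obtain C where C: "r\<^sup>2 < C" "C < r" "C * Re (v $ i) \<le> r\<^sup>2"
    proof (cases "Re (v $ i) \<le> 0")
      case True
      obtain C where C: "r\<^sup>2 < C" "C < r" using dense[OF r2] by blast
      then have "0 \<le> C" using zero_le_power2[of r] by linarith
      then have "C * Re (v $ i) \<le> 0" using True by (rule mult_nonneg_nonpos)
      then show ?thesis using that[OF C] zero_le_power2[of r] by linarith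
    next
      case False
      then have "r\<^sup>2 * Re (v $ i) < r\<^sup>2 * 1" using \<alpha> r by (intro mult_strict_left_mono) auto
      then have "r\<^sup>2 < min r (r\<^sup>2 / Re (v $ i))" using r2 False by (simp add: pos_less_divide_eq)
      then obtain C where C: "r\<^sup>2 < C" "C < min r (r\<^sup>2 / Re (v $ i))" using dense by blast
      then show ?thesis using that[of C] False by (simp add: pos_less_divide_eq less_imp_le)
    qed
    have C0: "0 < C" using C(1) zero_le_power2[of r] by linarith
    define s where "s = sqrt (r\<^sup>2 - C\<^sup>2)"
    have "C\<^sup>2 < r\<^sup>2" using C C0 r by (subst less_sq) auto
    then have s2: "s\<^sup>2 = r\<^sup>2 - C\<^sup>2" by (simp add: s_def)
    have cap: "r\<^sup>2 < Re (w * v $ i)" if w: "Re w = C" "(Im w)\<^sup>2 = s\<^sup>2" for w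
    proof -
      have "(cmod w)\<^sup>2 = r\<^sup>2" by (simp add: cmod_power2 w s2)
      then have cw: "cmod w = r" by (rule power2_eq_imp_eq) (simp_all add: r less_imp_le)
      then have nw: "norm (w *s e) = r" by (simp add: norm_vscale e)
      have "(rad m)\<^sup>2 < Re ((w *s e) $ g m)" if "norm (w *s e) = rad m" for m
      proof -
        have "m = k" using that unfolding nw r_def by simp
        then have "g m = i" "rad m = r" by (simp_all add: i_def r_def)
        then show ?thesis using C(1) w(1) e(2) by simp
      qed
      then have "w *s e \<in> perforated_ball g" unfolding perforated_ball_def using nw r by auto
      from D[OF this] have "w *s v \<in> perforated_ball g" by (simp only: Ascale)
      moreover have "norm (w *s v) = rad k" by (simp add: norm_vscale nv cw r_def)
      ultimately have "(rad k)\<^sup>2 < Re ((w *s v) $ g k)" unfolding perforated_ball_def by blast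
      then show ?thesis by (simp add: r_def i_def)
    qed
    have "r\<^sup>2 < Re (Complex C s * v $ i)" "r\<^sup>2 < Re (Complex C (- s) * v $ i)" by (rule cap; simp)+
    then have "2 * r\<^sup>2 < 2 * (C * Re (v $ i))" by simp
    then show False using C(3) by simp
  qed
  moreover have "Re (herm v e) = Re (v $ i)"
  proof -
    have "herm v e = (\<Sum>j\<in>UNIV. if j = i then v $ j else 0)"
      unfolding herm_def e_def by (rule sum.cong) (auto simp: axis_def)
    then show ?thesis by simp
  qed
  ultimately have "(norm (v - e))\<^sup>2 \<le> 0" unfolding norm_sq_diff nv e by simp
  then show ?thesis by (simp add: v_def e_def i_def)
qed

lemma perforated_ball_rigid:
  fixes f :: "complex ^ 'n \<Rightarrow> complex ^ 'n" and g :: "nat \<Rightarrow> 'n"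
  assumes card: "CARD('n) \<ge> 2" and g: "\<And>i. \<exists>k>0. g k = i"
    and f: "holomorphic_self_map f (perforated_ball g)"
    and ab: "a \<in> perforated_ball g" "b \<in> perforated_ball g" "a \<noteq> b" "f a = a" "f b = b"
    and z: "z \<in> perforated_ball g"
  shows "f z = z"
proof -
  let ?D = "perforated_ball g"
  have oD: "open ?D" by (rule open_perforated_ball)
  have hf: "holomorphic_map_on f ?D" and fD: "\<And>z. z \<in> ?D \<Longrightarrow> f z \<in> ?D"
    using f by (auto simp: holomorphic_self_map_def)
  have D1: "norm z < 1" if "z \<in> ?D" for z using that by (simp add: perforated_ball_def)
  have "\<exists>G. lhol G (ball 0 1) \<and> (\<forall>z\<in>?D. G z = f z $ i)" for i
  proof -
    have "continuous_on ?D (\<lambda>z. f z $ i)"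
      by (intro continuous_on_component holomorphic_map_continuous[OF hf])
    from perforated_ball_extension[OF card holomorphic_map_lhol[OF hf oD] this]
    show ?thesis by metis
  qed
  then obtain G where G: "\<And>i. lhol (G i) (ball 0 1)" "\<And>i z. z \<in> ?D \<Longrightarrow> G i z = f z $ i" by metis
  define F where "F z = (\<chi> i. G i z)" for z
  have hol: "lhol (\<lambda>z. F z $ i) (ball 0 1)" for i using G(1) by (simp add: F_def)
  have Ff: "F z = f z" if "z \<in> ?D" for z using G(2)[OF that] by (simp add: F_def vec_eq_iff)
  have F1: "norm (F z) < 1" if "norm z < 1" for z
    using lhol_self_map_of_ball[OF hol, of g] Ff fD D1 that by metis
  have contF: "continuous_on (ball 0 1) F" by (rule lhol_continuous_on_ball[OF hol F1])
  obtain c u s t where u: "norm u = 1" "herm c u = 0" "a = c + s *s u" "b = c + t *s u" "s \<noteq> t"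
    using line_normal_form[OF ab(3)] by metis
  have line: "F (c + x *s u) = c + x *s u" if "norm (c + x *s u) < 1" for x
    by (rule ball_self_map_fixes_line[OF hol F1 u(1,2) _ _ _ _ u(5) that])
       (use u ab D1 Ff in auto)
  note nl = norm_sq_orthogonal_line[OF u(2,1)]
  have "(norm c)\<^sup>2 \<le> (norm a)\<^sup>2" unfolding u(3) nl by simp
  then have "norm c \<le> norm a" by (rule power2_le_imp_le) simp
  then have c1: "norm c < 1" using D1[OF ab(1)] by linarith
  obtain k0 where k0: "\<And>k. k0 \<le> k \<Longrightarrow> rad k > 0"
    "\<And>k. k0 \<le> k \<Longrightarrow> \<exists>x. x \<noteq> 0 \<and> norm (c + x *s u) = rad k \<and> Re ((c + x *s u) $ g k) < (rad k)\<^sup>2"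
    using line_crosses_sphere_off_cap[OF u(1,2) c1, where g = g] by metis
  have sph: "norm (F q) = rad k" if k: "k0 \<le> k" and q: "norm q = rad k" for k q
  proof -
    note pos = k0(1)[OF k]
    obtain x where x: "x \<noteq> 0" "norm (c + x *s u) = rad k" "Re ((c + x *s u) $ g k) < (rad k)\<^sup>2"
      using k0(2)[OF k] by blast
    obtain m where m: "k = Suc m" using pos rad_0 by (cases k) auto
    define p where "p = c + x *s u"
    \<comment> \<open>A neighbourhood of the crossing point \<open>p\<close> off the cap and between
      the adjacent spheres: inside \<open>U\<close>, lying in \<open>D\<close> means lying off the
      sphere.\<close>
    define U where "U = {z. rad m < norm z \<and> norm z < rad (Suc k) \<and> Re (z $ g k) < (rad k)\<^sup>2}"
    have "open U" unfolding U_def by (intro open_Collect_conj open_Collect_less continuous_intros)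
    have "p \<in> U" using x unfolding U_def p_def m by simp
    have U1: "norm z < 1" if "z \<in> U" for z
      using that rad_less_1[of "Suc k"] unfolding U_def by (auto intro: less_trans)
    have UD: "z \<in> ?D \<longleftrightarrow> norm z \<noteq> rad k" if "z \<in> U" for z
      using that perforated_ball_local[of m z g] unfolding U_def m by auto
    have Fp: "F p = p" unfolding p_def by (rule line) (simp add: x(2))
    have "isCont F p"
      using contF U1[OF \<open>p \<in> U\<close>] by (simp add: continuous_on_eq_continuous_at)
    then have "eventually (\<lambda>z. F z \<in> U) (at p)"
      using topological_tendstoD[of F "F p" "at p" U] \<open>open U\<close> \<open>p \<in> U\<close> Fp by (simp add: isCont_def)
    moreover have "eventually (\<lambda>z. z \<in> U) (at p)"
      using \<open>open U\<close> \<open>p \<in> U\<close> by (intro eventually_at_in_open') auto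
    ultimately have "eventually (\<lambda>z. z \<in> U \<and> F z \<in> U) (at p)" by eventually_elim auto
    then obtain e where e: "e > 0" "\<And>z. z \<noteq> p \<Longrightarrow> dist z p < e \<Longrightarrow> z \<in> U \<and> F z \<in> U"
      unfolding eventually_at by blast
    then have eU: "z \<in> U" "F z \<in> U" if "z \<in> ball p e" for z
      using that Fp \<open>p \<in> U\<close> by (cases "z = p"; auto simp: dist_commute)+
    have near: "\<exists>w\<in>ball p \<epsilon>. norm w < rad k \<and> norm (F w) < rad k"
      "\<exists>w\<in>ball p \<epsilon>. norm w > rad k \<and> norm (F w) > rad k" if \<epsilon>: "\<epsilon> > 0" for \<epsilon>
    proof -
      \<comment> \<open>The witnesses on both sides are points \<open>c + (y * x) *s u\<close> with
        \<open>y = 1 - \<theta>\<close> and \<open>y = 1 + \<theta>\<close>. They are on the line,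
        hence fixed by \<open>F\<close>, and within \<open>min \<epsilon> e\<close> of
        \<open>p\<close>.\<close>
      define \<eta> where "\<eta> = min \<epsilon> e / (2 * cmod x)"
      define \<theta> where "\<theta> = min \<eta> (1 / 2)"
      have \<theta>: "0 < \<theta>" "\<theta> < 1" "\<theta> * cmod x < min \<epsilon> e"
      proof -
        have "\<eta> > 0" using \<epsilon> e(1) x(1) by (simp add: \<eta>_def)
        then show "0 < \<theta>" "\<theta> < 1" by (simp_all add: \<theta>_def)
        have "\<theta> * cmod x \<le> \<eta> * cmod x" by (intro mult_right_mono) (simp_all add: \<theta>_def)
        also have "\<dots> = min \<epsilon> e / 2" using x(1) by (simp add: \<eta>_def)
        also have "\<dots> < min \<epsilon> e" using half_gt_zero[of "min \<epsilon> e"] \<epsilon> e(1) by linarith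
        finally show "\<theta> * cmod x < min \<epsilon> e" .
      qed
      have w: "c + (of_real y * x) *s u \<in> ball p \<epsilon>" "F (c + (of_real y * x) *s u) = c + (of_real y * x) *s u"
        "(norm (c + (of_real y * x) *s u))\<^sup>2 = (norm c)\<^sup>2 + y\<^sup>2 * (cmod x)\<^sup>2"
        if y: "\<bar>1 - y\<bar> = \<theta>" for y
      proof -
        have "p - (c + (of_real y * x) *s u) = (of_real (1 - y) * x) *s u"
          by (simp add: p_def vec_eq_iff algebra_simps)
        then have "dist p (c + (of_real y * x) *s u) = \<bar>1 - y\<bar> * cmod x"
          unfolding dist_norm by (simp only: norm_vscale norm_mult norm_of_real u(1) mult_1_right)
        then have dd: "dist p (c + (of_real y * x) *s u) < min \<epsilon> e" using \<theta>(3) y by simp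
        then show "c + (of_real y * x) *s u \<in> ball p \<epsilon>" by simp
        have "c + (of_real y * x) *s u \<in> ball p e" using dd by simp
        from U1[OF eU(1)[OF this]] show "F (c + (of_real y * x) *s u) = c + (of_real y * x) *s u"
          by (rule line)
        show "(norm (c + (of_real y * x) *s u))\<^sup>2 = (norm c)\<^sup>2 + y\<^sup>2 * (cmod x)\<^sup>2"
          unfolding nl by (simp add: norm_mult power_mult_distrib)
      qed
      have rk: "(rad k)\<^sup>2 = (norm c)\<^sup>2 + (cmod x)\<^sup>2" using nl[of x] x(2) by simp
      show "\<exists>w\<in>ball p \<epsilon>. norm w < rad k \<and> norm (F w) < rad k"
      proof -
        have y: "\<bar>1 - (1 - \<theta>)\<bar> = \<theta>" using \<theta> by simp
        have "(1 - \<theta>)\<^sup>2 < 1\<^sup>2" using \<theta> by (subst less_sq) auto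
        then have "(1 - \<theta>)\<^sup>2 * (cmod x)\<^sup>2 < 1 * (cmod x)\<^sup>2" using x(1) by (intro mult_strict_right_mono) auto
        then have "(norm (c + (of_real (1 - \<theta>) * x) *s u))\<^sup>2 < (rad k)\<^sup>2"
          unfolding w(3)[OF y] rk by simp
        then have "norm (c + (of_real (1 - \<theta>) * x) *s u) < rad k" using pos by (subst (asm) less_sq) auto
        then show ?thesis using w(1,2)[OF y] by (metis (no_types))
      qed
      show "\<exists>w\<in>ball p \<epsilon>. norm w > rad k \<and> norm (F w) > rad k"
      proof -
        have y: "\<bar>1 - (1 + \<theta>)\<bar> = \<theta>" using \<theta> by simp
        have "1\<^sup>2 < (1 + \<theta>)\<^sup>2" using \<theta> by (subst less_sq) auto
        then have "1 * (cmod x)\<^sup>2 < (1 + \<theta>)\<^sup>2 * (cmod x)\<^sup>2" using x(1) by (intro mult_strict_right_mono) auto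
        then have "(rad k)\<^sup>2 < (norm (c + (of_real (1 + \<theta>) * x) *s u))\<^sup>2"
          unfolding w(3)[OF y] rk by simp
        then have "rad k < norm (c + (of_real (1 + \<theta>) * x) *s u)" using pos by (subst (asm) less_sq) auto
        then show ?thesis using w(1,2)[OF y] by (metis (no_types))
      qed
    qed
    have ne: "norm (F z) \<noteq> rad k" if z: "z \<in> ball p e" "norm z \<noteq> rad k" for z
    proof -
      have "z \<in> ?D" using UD[OF eU(1)[OF z(1)]] z(2) by simp
      then have "F z \<in> ?D" using Ff fD by simp
      then show ?thesis using UD[OF eU(2)[OF z(1)]] by simp
    qed
    have "ball p e \<subseteq> ball 0 1" using U1 eU(1) by auto
    then have cpe: "continuous_on (ball p e) F" by (rule continuous_on_subset[OF contF])
    obtain d where d: "d > 0" "\<And>z. z \<in> ball p d \<Longrightarrow> norm z = rad k \<Longrightarrow> norm (F z) = rad k"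
      using sphere_preserved_near_fixed_point[OF cpe e(1) x(2)[folded p_def] pos ne near] by metis
    show ?thesis by (rule sphere_preserved[OF hol pos rad_less_1 x(2)[folded p_def] d q])
  qed
  have radial: "\<exists>w. \<forall>t. cmod t < 1 \<longrightarrow> F (t *s v) = t *s w" if v: "norm v = 1" for v
  proof -
    obtain w where "\<And>t. cmod t < 1 \<Longrightarrow> F (0 + t *s v) = t *s w"
    proof (rule linear_of_norm_on_three_circles[of "\<lambda>t. F (0 + t *s v)" "rad k0" "rad (Suc k0)" "rad (Suc (Suc k0))"])
      show "(\<lambda>t. F (0 + t *s v) $ i) holomorphic_on ball 0 1" for i
        by (rule lholD[OF hol]) (simp add: norm_vscale v)
      show "norm (F (0 + t *s v)) = cmod t" if "cmod t \<in> {rad k0, rad (Suc k0), rad (Suc (Suc k0))}" for t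
      proof -
        from that obtain k where "k0 \<le> k" "cmod t = rad k" by (auto intro: le_SucI)
        then show ?thesis using sph[of k "t *s v"] by (simp add: norm_vscale v)
      qed
    qed (use k0(1) in auto)
    then show ?thesis by auto
  qed
  have 0: "0 \<in> ?D"
    using shell_subset[of 0 g] rad_0 rad_pos[of 1] by (auto simp: shell_def)
  \<comment> \<open>Homogeneity on each line through 0 does not give additivity by itself. The
    derivative of \<open>f\<close> at 0 does: it identifies the vector \<open>w\<close> of each
    direction \<open>v\<close> as \<open>A *v v\<close>.\<close>
  obtain A where A: "(f has_derivative (\<lambda>v. A *v v)) (at 0)"
    using holomorphic_map_onD[OF hf oD 0] by blast
  have Fsv: "F (t *s v) = t *s (A *v v)" if v: "norm v = 1" and t: "cmod t < 1" for v t
  proof -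
    obtain w where w: "\<And>t. cmod t < 1 \<Longrightarrow> F (t *s v) = t *s w" using radial[OF v] by blast
    have "(A *v v) $ i = w $ i" for i
    proof (rule DERIV_unique)
      show "((\<lambda>t. f (0 + t *s v) $ i) has_field_derivative (A *v v) $ i) (at 0)"
        by (rule has_field_derivative_line) (use A in simp)
      have "((\<lambda>t. t * w $ i) has_field_derivative w $ i) (at 0)"
        by (auto intro!: derivative_eq_intros)
      moreover have "open {t. 0 + t *s v \<in> ?D}" by (rule open_line_slice[OF oD])
      ultimately show "((\<lambda>t. f (0 + t *s v) $ i) has_field_derivative w $ i) (at 0)"
      proof (rule has_field_derivative_transform_within_open)
        show "0 \<in> {t. 0 + t *s v \<in> ?D}" using 0 by simp
        show "t * w $ i = f (0 + t *s v) $ i" if "t \<in> {t. 0 + t *s v \<in> ?D}" for t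
        proof -
          have "t *s v \<in> ?D" using that by simp
          moreover from D1[OF this] have "cmod t < 1" by (simp add: norm_vscale v)
          ultimately show ?thesis using w[of t] Ff[of "t *s v"] by (metis add_0 vector_smult_component)
        qed
      qed
    qed
    then have "A *v v = w" by (simp add: vec_eq_iff)
    then show ?thesis using w[OF t] by simp
  qed
  have FA: "F z = A *v z" if z: "norm z < 1" for z
  proof -
    obtain v where v: "norm v = 1" "z = of_real (norm z) *s v" by (rule unit_direction)
    have "F z = of_real (norm z) *s (A *v v)" using Fsv[OF v(1), of "of_real (norm z)"] z v(2) by simp
    also have "\<dots> = A *v (of_real (norm z) *s v)"
      by (simp add: matrix_vector_mult_def vec_eq_iff sum_distrib_left mult_ac)
    finally show ?thesis using v(2) by simp
  qed
  have iso: "norm (A *v z) = norm z" if z: "norm z < 1" for z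
  proof -
    obtain v where v: "norm v = 1" "z = of_real (norm z) *s v" by (rule unit_direction)
    have r: "rad k0 > 0" using k0(1) by simp
    have "norm (complex_of_real (rad k0) *s v) = rad k0"
      unfolding norm_vscale norm_of_real using r v(1) by simp
    from sph[OF order_refl this] have "rad k0 * norm (A *v v) = rad k0"
      using Fsv[OF v(1), of "of_real (rad k0)"] r by (simp add: norm_vscale)
    then have Av: "norm (A *v v) = 1" using r by simp
    have "F z = of_real (norm z) *s (A *v v)" using Fsv[OF v(1), of "of_real (norm z)"] z v(2) by simp
    then have "norm (F z) = norm z" by (simp add: norm_vscale Av)
    then show ?thesis using FA[OF z] by simp
  qed
  have AD: "A *v z \<in> ?D" if "z \<in> ?D" for z
    using FA[OF D1[OF that]] Ff[OF that] fD[OF that] by simp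
  have "A *v axis i 1 = axis i 1" for i
  proof -
    obtain k where "k > 0" "g k = i" using g by blast
    then show ?thesis using unitary_preserving_cap_fixes_axis[OF iso _ AD, of k] by metis
  qed
  moreover have "(A *v axis i 1) $ j = A $ j $ i" for i j
  proof -
    have "(A *v axis i 1) $ j = (\<Sum>l\<in>UNIV. if l = i then A $ j $ l else 0)"
      unfolding matrix_vector_mult_def vec_lambda_beta by (rule sum.cong) (auto simp: axis_def)
    then show ?thesis by simp
  qed
  ultimately have "A $ j $ i = axis i 1 $ j" for i j by metis
  then have "A = mat 1" by (simp add: vec_eq_iff mat_def axis_def eq_commute)
  then show ?thesis using FA[OF D1[OF z]] Ff[OF z] by simp
qed

text \<open>In dimension one the complex line through two fixed points is the whole space, so the
  fixed-line lemma for the ball already gives the identity.\<close>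

lemma unit_disc_rigid:
  fixes f :: "complex ^ 'n \<Rightarrow> complex ^ 'n"
  assumes card: "CARD('n) = 1" and f: "holomorphic_self_map f (ball 0 1)"
    and ab: "a \<in> ball 0 1" "b \<in> ball 0 1" "a \<noteq> b" "f a = a" "f b = b" and z: "z \<in> ball 0 1"
  shows "f z = z"
proof -
  obtain i :: 'n where i: "UNIV = {i}" using card card_1_singletonE by blast
  have hf: "holomorphic_map_on f (ball 0 1)" and f1: "norm (f z) < 1" if "norm z < 1" for z
    using f that by (auto simp: holomorphic_self_map_def image_subset_iff)
  obtain c u s t where u: "norm u = 1" "herm c u = 0" "a = c + s *s u" "b = c + t *s u" "s \<noteq> t"
    using line_normal_form[OF ab(3)] by metis
  have all: "j = i" for j using i by (metis UNIV_I singletonD)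
  have "u $ i \<noteq> 0"
  proof
    assume "u $ i = 0"
    then have "u = 0" using all by (metis vec_eq_iff zero_index)
    then show False using u(1) by simp
  qed
  have "z = c + ((z $ i - c $ i) / u $ i) *s u"
    unfolding vec_eq_iff
  proof
    fix j
    have "j = i" by (rule all)
    with \<open>u $ i \<noteq> 0\<close> show "z $ j = (c + ((z $ i - c $ i) / u $ i) *s u) $ j" by simp
  qed
  moreover have "f (c + x *s u) = c + x *s u" if "norm (c + x *s u) < 1" for x
    by (rule ball_self_map_fixes_line[OF holomorphic_map_lhol[OF hf open_ball] f1 u(1,2) _ _ _ _ u(5) that])
       (use u ab in auto)
  ultimately show ?thesis using z by (metis mem_ball_0)
qed

lemma retraction_trivial_if_two_fixed_points_rigid:
  assumes rigid: "\<And>f. holomorphic_self_map f D \<Longrightarrow> \<exists>a\<in>D. \<exists>b\<in>D. a \<noteq> b \<and> f a = a \<and> f b = b \<Longrightarrow>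
      \<forall>z\<in>D. f z = z"
    and f: "holomorphic_retraction f D"
  shows "trivial_on f D"
proof (cases "f constant_on D")
  case False
  then obtain x y where xy: "x \<in> D" "y \<in> D" "f x \<noteq> f y" unfolding constant_on_def by metis
  have "holomorphic_self_map f D" "\<And>z. z \<in> D \<Longrightarrow> f z \<in> D" "\<And>z. z \<in> D \<Longrightarrow> f (f z) = f z"
    using f by (auto simp: holomorphic_retraction_def holomorphic_self_map_def)
  then have "\<forall>z\<in>D. f z = z" using xy by (intro rigid) metis+
  then show ?thesis by (simp add: trivial_on_def)
qed (simp add: trivial_on_def)

theorem corollary4p2:
  shows "\<exists>D :: (complex ^ 'n) set.
    cn_domain D \<and> bounded D \<and>
    (\<forall>f. holomorphic_self_map f D \<and> (\<exists>a\<in>D. \<exists>b\<in>D. a \<noteq> b \<and> f a = a \<and> f b = b)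
       \<longrightarrow> (\<forall>z\<in>D. f z = z)) \<and>
    (\<forall>f. holomorphic_retraction f D \<longrightarrow> trivial_on f D)"
proof -
  obtain D :: "(complex ^ 'n) set" where D: "cn_domain D" "bounded D"
    "\<And>f. holomorphic_self_map f D \<Longrightarrow> \<exists>a\<in>D. \<exists>b\<in>D. a \<noteq> b \<and> f a = a \<and> f b = b \<Longrightarrow> \<forall>z\<in>D. f z = z"
  proof (cases "CARD('n) = 1")
    case True
    show ?thesis
    proof (rule that[of "ball 0 1"])
      show "cn_domain (ball (0 :: complex ^ 'n) 1)" by (simp add: cn_domain_def)
    qed (use unit_disc_rigid[OF True] in blast)+
  next
    case False
    moreover have "CARD('n) > 0" by simp
    ultimately have card: "CARD('n) \<ge> 2" by linarith
    \<comment> \<open>The shift by one lets every coordinate occur at a positive index, since index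
      0 removes no sphere; once the finite type is exhausted, \<open>g\<close> takes a default
      value.\<close>
    define g :: "nat \<Rightarrow> 'n" where "g k = from_nat_into UNIV (k - 1)" for k
    have g: "\<exists>k>0. g k = i" for i
    proof -
      have "i \<in> range (from_nat_into UNIV)"
        using range_from_nat_into[of "UNIV :: 'n set"] by (simp add: countable_finite)
      then obtain m where "i = from_nat_into UNIV m" by blast
      then show ?thesis by (intro exI[of _ "Suc m"]) (simp add: g_def)
    qed
    show ?thesis
    proof (rule that[of "perforated_ball g"])
      have "0 \<in> perforated_ball g"
        using shell_subset[of 0 g] rad_0 rad_pos[of 1] by (auto simp: shell_def)
      then show "cn_domain (perforated_ball g)"
        using open_perforated_ball connected_perforated_ball by (auto simp: cn_domain_def)
      show "bounded (perforated_ball g)"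
        by (rule bounded_subset[OF bounded_ball[of 0 1]]) (auto simp: perforated_ball_def)
    qed (use perforated_ball_rigid[OF card g] in blast)
  qed
  moreover have "trivial_on f D" if "holomorphic_retraction f D" for f
    by (rule retraction_trivial_if_two_fixed_points_rigid[OF D(3) that])
  ultimately show ?thesis by blast
qed

end
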